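(* Let $T>0$, let $V:\mathcal P(\mathbb R^d)\to\mathcal P(T\mathbb R^d)$ be a probability vector field, and let $\mu_0\in\mathcal P(\mathbb R^d)$. Let $\boldsymbol\eta\in\mathcal P(\Gamma_{[0,T]})$ satisfy $e_0\sharp\boldsymbol\eta=\mu_0$ and the following conditions: (i) $\boldsymbol\eta$ is concentrated on curves $\gamma\in AC([0,T];\mathbb R^d)$; (ii) for a.e. $t\in[0,T]$ and for $e_t\sharp\boldsymbol\eta$-a.e. $y\in\mathbb R^d$, $$\int_{e_t^{-1}(y)}\dot\gamma(t)\,d\eta_{t,y}(\gamma)=\int_{\mathbb R^d}v\,d\nu_y[e_t\sharp\boldsymbol\eta](v),$$ where $\{\eta_{t,y}\}_y$ is the disintegration of $\boldsymbol\eta$ with respect to $e_t$ and $\{\nu_y[e_t\sharp\boldsymbol\eta]\}_y$ is the disintegration of $V[e_t\sharp\boldsymbol\eta]$ with respect to $\pi_1$; (iii) $\displaystyle\int_0^T\int_{\Gamma_{[0,T]}}|\dot\gamma(t)|\,d\boldsymbol\eta(\gamma)\,dt<+\infty$ and $\displaystyle\int_0^T\int_{T\mathbb R^d}|v|\,dV[e_t\sharp\boldsymbol\eta](x,v)\,dt<+\infty$. Then, setting $\mu_t:=e_t\sharp\boldsymbol\eta$, the family $\boldsymbol\mu=\{\mu_t\}_{t\in[0,T]}$ is a solution of the Cauchy problem $\dot\mu_t=V[\mu_t]$ on $(0,T)$, $\mu_{t=0}=\mu_0$.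
   Context: Notation: $\mathcal P(X)$ is the set of Borel probability measures on $X$; $T\mathbb R^d=\mathbb R^d\times\mathbb R^d$ with elements $(x,v)$; $\pi_1(x,v)=x$; $\sharp$ denotes push-forward; $\langle\mu,f\rangle=\int f\,d\mu$. $\Gamma_{[0,T]}$ is the space of continuous curves $[0,T]\to\mathbb R^d$ with the sup norm; $e_t:\Gamma_{[0,T]}\to\mathbb R^d$, $e_t(\gamma)=\gamma(t)$; $AC([0,T];\mathbb R^d)$ is the set of absolutely continuous curves. A probability vector field (PVF) is a map $V:\mathcal P(\mathbb R^d)\to\mathcal P(T\mathbb R^d)$ with $\pi_1\sharp V[\mu]=\mu$ for all $\mu$; its disintegration is $V[\mu]=\mu\otimes\nu_x[\mu]$, i.e. $\int g\,dV[\mu]=\int\int g(x,v)\,d\nu_x[\mu](v)\,d\mu(x)$ with $\nu_x[\mu]\in\mathcal P(\mathbb R^d)$. Similarly $\boldsymbol\eta=(e_t\sharp\boldsymbol\eta)\otimes\eta_{t,y}$ with $\eta_{t,y}$ concentrated on $e_t^{-1}(y)$. Solution of $\dot\mu_t=V[\mu_t]$, $\mu_{t=0}=\mu_0$ on $[0,T]$: a map $t\mapsto\mu_t\in\mathcal P(\mathbb R^d)$ with $\mu_{t=0}=\mu_0$ such that for every $f\in C_c^\infty(\mathbb R^d)$ the quantity $\int_{T\mathbb R^d}\nabla f(x)\cdot v\,dV[\mu_t](x,v)$ is defined for a.e. $t$ and is in $L^1([0,T])$ as a function of $t$, the map $t\mapsto\langle\mu_t,f\rangle$ is absolutely continuous,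 and $\frac{d}{dt}\langle\mu_t,f\rangle=\int_{T\mathbb R^d}\nabla f(x)\cdot v\,dV[\mu_t](x,v)$ for a.e. $t\in[0,T]$. *)

theory Defs
  imports "HOL-Probability.Probability"
begin

abbreviation borel_probs :: "'a::topological_space measure set"
  where "borel_probs \<equiv> space (prob_algebra borel)"

(* The underlying functions are extensional: they take the value undefined outside {0..T}.
   The metric is the sup metric. *)
definition curve_metric :: "real \<Rightarrow> (real \<Rightarrow> 'a::euclidean_space) metric"
  where "curve_metric T = cfunspace (top_of_set {0..T}) euclidean_metric"

definition curve_borel :: "real \<Rightarrow> (real \<Rightarrow> 'a::euclidean_space) measure"
  where "curve_borel T =
    sigma (mspace (curve_metric T)) {U. openin (mtopology_of (curve_metric T)) U}"

definition eval_at :: "real \<Rightarrow> (real \<Rightarrow> 'a) \<Rightarrow> 'a"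
  where "eval_at t \<gamma> = \<gamma> t"

definition absolutely_continuous_on :: "real \<Rightarrow> real \<Rightarrow> (real \<Rightarrow> 'a::metric_space) \<Rightarrow> bool"
  where "absolutely_continuous_on a b g \<longleftrightarrow>
    (\<forall>\<epsilon>>0. \<exists>\<delta>>0. \<forall>(n::nat) l r.
       (\<forall>i<n. a \<le> l i \<and> l i \<le> r i \<and> r i \<le> b) \<longrightarrow>
       disjoint_family_on (\<lambda>i. {l i<..<r i}) {..<n} \<longrightarrow>
       (\<Sum>i<n. r i - l i) < \<delta> \<longrightarrow> (\<Sum>i<n. dist (g (l i)) (g (r i))) < \<epsilon>)"

(* One-sided at the end points of {0..T}; an unspecified constant wherever the
   derivative does not exist. *)
definition velocity :: "real \<Rightarrow> (real \<Rightarrow> 'a::euclidean_space) \<Rightarrow> real \<Rightarrow> 'a"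
  where "velocity T \<gamma> t = vector_derivative \<gamma> (at t within {0..T})"

definition disintegration_along ::
    "'b measure \<Rightarrow> ('b \<Rightarrow> 'a::topological_space) \<Rightarrow> ('a \<Rightarrow> 'b measure) \<Rightarrow> bool"
  where "disintegration_along M p \<kappa> \<longleftrightarrow>
    \<kappa> \<in> borel \<rightarrow>\<^sub>M prob_algebra M \<and>
    (AE y in distr M borel p. AE z in \<kappa> y. p z = y) \<and>
    (\<forall>g\<in>borel_measurable M. (\<integral>\<^sup>+z. g z \<partial>M) = (\<integral>\<^sup>+y. (\<integral>\<^sup>+z. g z \<partial>\<kappa> y) \<partial>distr M borel p))"

(* Along the first projection of a product, the fibre over x is identified with the
   second factor, so that M is the measure (fst # M) (x) nu_x. *)
definition disintegration_fst ::
    "('a::topological_space \<times> 'b::topological_space) measure \<Rightarrow> ('a \<Rightarrow> 'b measure) \<Rightarrow> bool"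
  where "disintegration_fst M \<nu> \<longleftrightarrow>
    \<nu> \<in> borel \<rightarrow>\<^sub>M prob_algebra borel \<and>
    (\<forall>g\<in>borel_measurable borel.
       (\<integral>\<^sup>+z. g z \<partial>M) = (\<integral>\<^sup>+x. (\<integral>\<^sup>+v. g (x, v) \<partial>\<nu> x) \<partial>distr M borel fst))"

primrec C_k :: "nat \<Rightarrow> ('a::euclidean_space \<Rightarrow> real) \<Rightarrow> bool"
  where
    "C_k 0 f \<longleftrightarrow> continuous_on UNIV f"
  | "C_k (Suc k) f \<longleftrightarrow> (\<forall>x. f differentiable (at x)) \<and>
       (\<forall>b\<in>Basis. C_k k (\<lambda>x. frechet_derivative f (at x) b))"

definition test_functions :: "('a::euclidean_space \<Rightarrow> real) set"
  where "test_functions = {f. (\<forall>k. C_k k f) \<and> compact (closure {x. f x \<noteq> 0})}"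

definition grad :: "('a::euclidean_space \<Rightarrow> real) \<Rightarrow> 'a \<Rightarrow> 'a"
  where "grad f x = (\<Sum>b\<in>Basis. frechet_derivative f (at x) b *\<^sub>R b)"

(* Only the values of V on borel_probs are constrained. *)
definition prob_vector_field ::
    "('a::euclidean_space measure \<Rightarrow> ('a \<times> 'a) measure) \<Rightarrow> bool"
  where "prob_vector_field V \<longleftrightarrow>
    (\<forall>\<mu>\<in>borel_probs. V \<mu> \<in> borel_probs \<and> distr (V \<mu>) borel fst = \<mu>)"

(* An integral over the tangent bundle is defined when its integrand is integrable; the Bochner
   integral is 0 otherwise, which by the first condition only matters for t in a null set. *)
definition mde_solution ::
    "real \<Rightarrow> ('a::euclidean_space measure \<Rightarrow> ('a \<times> 'a) measure) \<Rightarrow> 'a measure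
      \<Rightarrow> (real \<Rightarrow> 'a measure) \<Rightarrow> bool"
  where "mde_solution T V \<mu>0 \<mu> \<longleftrightarrow>
    (\<forall>t\<in>{0..T}. \<mu> t \<in> borel_probs) \<and> \<mu> 0 = \<mu>0 \<and>
    (\<forall>f\<in>test_functions.
       (AE t in lebesgue_on {0..T}. integrable (V (\<mu> t)) (\<lambda>(x, v). grad f x \<bullet> v)) \<and>
       integrable (lebesgue_on {0..T}) (\<lambda>t. LINT (x, v)|V (\<mu> t). grad f x \<bullet> v) \<and>
       absolutely_continuous_on 0 T (\<lambda>t. LINT x|\<mu> t. f x) \<and>
       (AE t in lebesgue_on {0..T}.
          ((\<lambda>s. LINT x|\<mu> s. f x) has_real_derivative (LINT (x, v)|V (\<mu> t). grad f x \<bullet> v))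
            (at t within {0..T})))"

end

theory Submission
  imports Defs
begin

text \<open>
  For a test function \<open>f\<close> and an absolutely continuous curve \<open>\<gamma>\<close>, the function \<open>f \<circ> \<gamma>\<close> is
  absolutely continuous, so \<open>f (\<gamma> t) - f (\<gamma> 0)\<close> is the integral over \<open>[0, t]\<close> of
  \<open>\<nabla>f (\<gamma> s) \<bullet> \<gamma>' s\<close>. Integrating over the curves, Fubini's theorem (whose hypothesis is the first
  bound of (iii)) shows that \<open>\<langle>\<mu>\<^sub>t, f\<rangle>\<close> is the primitive of
  \<open>g s = \<integral> \<nabla>f (\<gamma> s) \<bullet> \<gamma>' s d\<eta>\<close>; hence it is absolutely continuous with derivative \<open>g\<close> almost
  everywhere. Disintegrating along \<open>e\<^sub>s\<close>, the factor \<open>\<nabla>f\<close> is constant on each fibre, and (ii)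
  replaces the mean velocity of the fibre by the mean of \<open>\<nu>\<^sub>y\<close>, so \<open>g s\<close> is the integral of
  \<open>\<nabla>f (x) \<bullet> v\<close> against \<open>V[\<mu>\<^sub>s]\<close>.

  The fundamental theorem of calculus for absolutely continuous functions is obtained from Lebesgue's
  differentiation theorem (via Vitali coverings) and the Radon-Nikodym theorem, applied to the
  Stieltjes measures of the two monotone functions in the Jordan decomposition by total variation.
\<close>

subsection \<open>Lebesgue's differentiation theorem on the real line\<close>

text \<open>Three obstacles shape the work. Fubini's theorem needs the velocity jointly measurable
  in time and curve, although a derivative exists only at some pairs: differentiability is therefore
  rewritten as a Cauchy condition on rational difference quotients, and \<open>clip\<close> turns a
  curve, which is \<open>undefined\<close> outside [0, T], into a continuous function on the whole
  line. Next, \<open>V\<close> carries no measurability in its argument, so the field integral of a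
  test function becomes measurable in time only through its almost everywhere equality with the
  Fubini integral \<open>g\<close> and the completeness of Lebesgue measure. Finally, (ii) is an
  identity of Bochner integrals, which are 0 for non-integrable integrands; pairing it with the
  gradient is legitimate because the two bounds of (iii) make the velocity and \<open>v\<close>
  integrable on almost every fibre at almost every time. The fundamental theorem is used twice per
  curve: on the coordinates, for existence of the velocity, and on \<open>f\<close> along the curve,
  for the integral formula; the chain rule then identifies the Radon-Nikodym density.\<close>

text \<open>Outer regularity puts \<open>A\<close> inside an open set \<open>U\<close> with
  \<open>emeasure N U < e * d\<close>. Every bad point is the centre of arbitrarily small balls
  inside \<open>U\<close> on which \<open>N\<close> exceeds \<open>e\<close> times Lebesgue measure;
  a disjoint Vitali subfamily \<open>C\<close> covers the bad points up to a negligible set, and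
  summing over it bounds \<open>e\<close> times the measure of its union by
  \<open>emeasure N U\<close>. Hence the bad set has outer measure at most \<open>d\<close>, for
  every \<open>d\<close>.\<close>

lemma AE_eventually_measure_cball_le:
  fixes N :: "'a::euclidean_space measure"
  assumes N: "finite_measure N" "sets N = sets borel" and A: "A \<in> sets borel" "emeasure N A = 0"
  shows "AE x in lborel. x \<in> A \<longrightarrow>
    (\<forall>e>0. \<forall>\<^sub>F r in at_right 0. measure N (cball x r) \<le> e * measure lborel (cball x r))"
proof -
  interpret N: finite_measure N by fact
  define S where "S e = {x\<in>A. \<not> (\<forall>\<^sub>F r in at_right 0. measure N (cball x r) \<le> e * measure lborel (cball x r))}" for e
  have neg: "negligible (S e)" if e: "e > 0" for e
    \<comment> \<open>Measurability of \<open>S e\<close> is not established, so it is enclosed in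
      measurable sets of arbitrarily small measure.\<close>
    unfolding negligible_outer_le
  proof (intro allI impI)
    fix d :: real assume d: "d > 0"
    have "(INF U \<in> {U. A \<subseteq> U \<and> open U}. emeasure N U) < ennreal (e * d)"
      using outer_regular[OF N(2) _ A(1)] A(2) e d N.emeasure_finite by (simp add: less_top)
    then obtain U where U: "A \<subseteq> U" "open U" "emeasure N U < ennreal (e * d)"
      by (auto simp: INF_less_iff)
    define K where "K = {(x, r). x \<in> S e \<and> 0 < r \<and> cball x r \<subseteq> U \<and>
        e * measure lborel (cball x r) < measure N (cball x r)}"
    have fine: "\<exists>i. i \<in> K \<and> x \<in> cball (fst i) (snd i) \<and> snd i < \<delta>" if x: "x \<in> S e" and \<delta>: "0 < \<delta>" for x \<delta>
    proof -
      have "x \<in> U" using x U by (auto simp: S_def)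
      then obtain \<rho> where \<rho>: "\<rho> > 0" "cball x \<rho> \<subseteq> U"
        using U open_contains_cball by blast
      have "\<not> (\<forall>r>0. r < min \<rho> \<delta> \<longrightarrow> measure N (cball x r) \<le> e * measure lborel (cball x r))"
        using x \<delta> \<rho> unfolding S_def eventually_at_right_field by (auto dest!: spec[of _ "min \<rho> \<delta>"])
      then obtain r where r: "0 < r" "r < min \<rho> \<delta>" "e * measure lborel (cball x r) < measure N (cball x r)"
        by auto
      moreover have "cball x r \<subseteq> U" using \<rho> r by (meson less_eq_real_def min_less_iff_conj subset_cball subset_trans)
      ultimately show ?thesis using x by (intro exI[of _ "(x, r)"]) (auto simp: K_def)
    qed
    obtain C where C: "countable C" "C \<subseteq> K"
      "pairwise (\<lambda>i j. disjnt (cball (fst i) (snd i)) (cball (fst j) (snd j))) C"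
      "negligible (S e - (\<Union>i \<in> C. cball (fst i) (snd i)))"
    proof (rule Vitali_covering_theorem_cballs[of K snd "S e" fst])
      show "0 < snd i" if "i \<in> K" for i using that by (auto simp: K_def)
    qed (use fine in blast)+
    define B where "B i = cball (fst i) (snd i)" for i :: "'a \<times> real"
    have disj: "disjoint_family_on B C"
      using C(3) by (auto simp: disjoint_family_on_def pairwise_def disjnt_def B_def)
    have le: "ennreal e * emeasure lborel (B i) \<le> emeasure N (B i)" if "i \<in> C" for i
    proof -
      have "e * measure lborel (B i) \<le> measure N (B i)" using that C(2) by (auto simp: K_def B_def)
      moreover have "emeasure lborel (B i) = measure lborel (B i)"
        by (rule emeasure_eq_ennreal_measure) (use emeasure_lborel_cball_finite[of "fst i" "snd i"] in \<open>simp add: B_def\<close>)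
      ultimately show ?thesis
        using e by (simp add: N.emeasure_eq_measure ennreal_mult[symmetric])
    qed
    let ?W = "\<Union>i\<in>C. B i"
    have [measurable]: "?W \<in> sets borel" using C(1) by (intro sets.countable_UN') (auto simp: B_def)
    have "ennreal e * emeasure lborel ?W = (\<integral>\<^sup>+i. ennreal e * emeasure lborel (B i) \<partial>count_space C)"
      using C(1) disj by (subst emeasure_UN_countable) (auto simp: B_def nn_integral_cmult)
    also have "\<dots> \<le> (\<integral>\<^sup>+i. emeasure N (B i) \<partial>count_space C)"
      by (intro nn_integral_mono) (simp add: le)
    also have "\<dots> = emeasure N ?W"
      using C(1) disj by (subst emeasure_UN_countable) (auto simp: B_def N(2))
    also have "\<dots> \<le> emeasure N U"
    proof (rule emeasure_mono)
      have "cball (fst i) (snd i) \<subseteq> U" if "i \<in> C" for i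
      proof -
        have "i \<in> K" using that C(2) by blast
        then show ?thesis by (cases i) (simp add: K_def)
      qed
      then show "?W \<subseteq> U" unfolding B_def by blast
    qed (use U(2) N(2) in auto)
    also have "\<dots> < ennreal (e * d)" by fact
    finally have "ennreal e * emeasure lborel ?W < ennreal e * ennreal d"
      using e d by (simp add: ennreal_mult)
    then have W: "emeasure lborel ?W < ennreal d"
      by (meson ennreal_mult_left_cong linorder_not_le mult_left_mono zero_le)
    have Wm: "?W \<in> lmeasurable" using less_trans[OF W ennreal_less_top] by (auto simp: fmeasurable_def)
    have "measure lebesgue ?W \<le> d"
      using W d by (simp add: measure_def enn2real_leI)
    moreover obtain Z where Z: "Z = S e - ?W" "Z \<in> null_sets lebesgue"
      using C(4) by (auto simp: B_def negligible_iff_null_sets)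
    moreover have "?W \<union> Z \<in> lmeasurable"
      using Wm Z(2) by (intro fmeasurable.Un) (auto simp: fmeasurable_def)
    moreover have "measure lebesgue (?W \<union> Z) = measure lebesgue ?W"
      using Wm Z(2) by (intro measure_Un_null_set) auto
    ultimately show "\<exists>T. S e \<subseteq> T \<and> T \<in> lmeasurable \<and> measure lebesgue T \<le> d"
      by (intro exI[of _ "?W \<union> Z"]) auto
  qed
  \<comment> \<open>Countably many thresholds suffice, since the estimate with a smaller factor
    implies the one with a larger factor.\<close>
  have "AE x in lborel. \<forall>k::nat. x \<notin> S (1 / Suc k)"
    unfolding AE_all_countable
  proof
    fix k :: nat
    show "AE x in lborel. x \<notin> S (1 / Suc k)"
      using neg[of "1 / Suc k"] AE_not_in[of "S (1 / Suc k)" lebesgue]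
      by (simp add: negligible_iff_null_sets AE_completion_iff)
  qed
  then show ?thesis
  proof (eventually_elim, intro impI allI)
    fix x and e :: real
    assume x: "\<forall>k. x \<notin> S (1 / real (Suc k))" "x \<in> A" and e: "0 < e"
    obtain k where k: "1 / Suc k < e" using e nat_approx_posE by blast
    have "\<forall>\<^sub>F r in at_right 0. measure N (cball x r) \<le> 1 / Suc k * measure lborel (cball x r)"
      using x unfolding S_def by blast
    then show "\<forall>\<^sub>F r in at_right 0. measure N (cball x r) \<le> e * measure lborel (cball x r)"
      by eventually_elim (use k in \<open>meson less_eq_real_def measure_nonneg mult_right_mono order_trans\<close>)
  qed
qed

text \<open>Where \<open>g \<le> q\<close>, the measure with density \<open>(g - q)\<^sup>+\<close> is negligible on small balls by the
  previous lemma, so the averages of \<open>g\<close> are asymptotically at most \<open>q\<close>; now let \<open>q\<close> decrease to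
  \<open>g x\<close> through the rationals. The truncation to \<open>(-n, n)\<close> makes these measures finite.\<close>

lemma AE_eventually_average_le:
  fixes g :: "real \<Rightarrow> real"
  assumes g: "integrable lborel g"
  shows "AE x in lborel. \<forall>e>0. \<forall>\<^sub>F r in at_right 0. \<forall>I\<in>{{x<..x + r}, {x - r<..x}}.
    (LINT s|lborel. indicator I s * g s) \<le> (g x + e) * r"
proof -
  have [measurable]: "g \<in> borel_measurable borel" using g by auto
  define N where "N q n = density lborel (\<lambda>s. ennreal (indicator {-real n<..<real n} s * max 0 (g s - q)))" for q :: real and n
  have intN: "integrable lborel (\<lambda>s. indicator {-real n<..<real n} s * max 0 (g s - q))" for q n
  proof (rule Bochner_Integration.integrable_bound)
    show "integrable lborel (\<lambda>s. norm (g s) + indicator {-real n<..<real n} s * \<bar>q\<bar>)"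
      using g by (intro Bochner_Integration.integrable_add integrable_norm integrable_mult_left integrable_real_indicator) auto
  qed (auto simp: indicator_def)
  have N: "finite_measure (N q n)" "sets (N q n) = sets borel" for q n
    unfolding N_def using integrableD(2)[OF intN[of n q]]
    by (auto intro!: finite_measureI simp: emeasure_density less_top abs_mult ennreal_mult ennreal_indicator)
  have [measurable]: "cball x r \<in> sets borel" for x r :: real by simp
  have Nm: "measure (N q n) (cball x r) = (LINT s|lborel. indicator (cball x r) s * (indicator {-real n<..<real n} s * max 0 (g s - q)))" for q n x r
    unfolding measure_def N_def
    by (subst integral_eq_nn_integral)
       (auto simp: emeasure_density ennreal_mult ennreal_indicator intro!: arg_cong[where f=enn2real] nn_integral_cong split: split_indicator)
  have "AE x in lborel. \<forall>q\<in>\<rat>. \<forall>n. x \<in> {x. -real n < x \<and> x < real n \<and> g x \<le> q} \<longrightarrow>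
      (\<forall>e>0. \<forall>\<^sub>F r in at_right 0. measure (N q n) (cball x r) \<le> e * measure lborel (cball x r))"
    unfolding AE_ball_countable[OF countable_rat] AE_all_countable
    by (intro ballI allI AE_eventually_measure_cball_le N)
       (auto simp: N_def emeasure_density nn_integral_0_iff_AE intro!: nn_integral_zero' AE_I2 split: split_indicator)
  then show ?thesis
  proof (eventually_elim, intro allI impI)
    fix x and e :: real
    assume x: "\<forall>q\<in>\<rat>. \<forall>n. x \<in> {x. -real n < x \<and> x < real n \<and> g x \<le> q} \<longrightarrow>
      (\<forall>e>0. \<forall>\<^sub>F r in at_right 0. measure (N q n) (cball x r) \<le> e * measure lborel (cball x r))" and e: "e > 0"
    obtain q where q: "q \<in> \<rat>" "g x < q" "q < g x + e / 2"
      using Rats_dense_in_real[of "g x" "g x + e / 2"] e by auto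
    obtain n where n: "\<bar>x\<bar> < real n" using reals_Archimedean2 by blast
    \<comment> \<open>The ball has length \<open>2 * r\<close>, so \<open>e / 4\<close> costs
      \<open>e / 2 * r\<close>, which together with \<open>q < g x + e / 2\<close> stays within the
      allowed error.\<close>
    have "\<forall>\<^sub>F r in at_right 0. measure (N q n) (cball x r) \<le> e / 4 * measure lborel (cball x r)"
      using x q n e by (auto dest!: bspec[of _ _ q] spec[of _ n] spec[of _ "e / 4"])
    moreover have "\<forall>\<^sub>F r in at_right 0. r < real n - \<bar>x\<bar>"
      using n by (auto simp: eventually_at_right_field intro!: exI[of _ "real n - \<bar>x\<bar>"])
    moreover have "\<forall>\<^sub>F r in at_right (0::real). 0 < r"
      by (simp add: eventually_at_right_less)
    ultimately show "\<forall>\<^sub>F r in at_right 0. \<forall>I\<in>{{x<..x + r}, {x - r<..x}}.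
      (LINT s|lborel. indicator I s * g s) \<le> (g x + e) * r"
    proof (eventually_elim, intro ballI)
      fix r I assume r: "measure (N q n) (cball x r) \<le> e / 4 * measure lborel (cball x r)"
        "r < real n - \<bar>x\<bar>" "0 < r" and I: "I \<in> {{x<..x + r}, {x - r<..x}}"
      have [measurable]: "I \<in> sets borel" and mI: "measure lborel I = r" and fI: "emeasure lborel I < \<infinity>"
        using I r(3) by auto
      have "(LINT s|lborel. indicator I s * g s) \<le>
        (LINT s|lborel. q * indicator I s + indicator (cball x r) s * (indicator {-real n<..<real n} s * max 0 (g s - q)))"
      proof (rule integral_mono)
        show "integrable lborel (\<lambda>s. indicator I s * g s)"
          using integrable_mult_indicator[OF _ g, of I] by simp
        show "integrable lborel (\<lambda>s. q * indicator I s + indicator (cball x r) s * (indicator {-real n<..<real n} s * max 0 (g s - q)))"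
          using integrable_mult_indicator[OF _ intN, of "cball x r" n q] fI
          by (intro Bochner_Integration.integrable_add integrable_mult_right integrable_real_indicator) auto
        \<comment> \<open>The bound on \<open>r\<close> keeps \<open>I\<close> inside the truncation
          interval, where \<open>g\<close> is at most \<open>q + max 0 (g - q)\<close>.\<close>
        show "indicator I s * g s \<le> q * indicator I s + indicator (cball x r) s * (indicator {-real n<..<real n} s * max 0 (g s - q))" for s
          using I r by (auto simp: indicator_def dist_real_def)
      qed
      also have "\<dots> = q * r + measure (N q n) (cball x r)"
        using integrable_mult_indicator[OF _ intN, of "cball x r" n q] fI
        by (subst Bochner_Integration.integral_add)
           (auto simp: Nm mI intro!: integrable_mult_right integrable_real_indicator)
      also have "\<dots> \<le> q * r + e / 4 * (2 * r)"
        using r by (simp add: cball_eq_atLeastAtMost)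
      also have "\<dots> \<le> (g x + e) * r"
      proof -
        have "(q + e / 2) * r \<le> (g x + e) * r" using q r by (intro mult_right_mono) auto
        then show ?thesis by (simp add: algebra_simps)
      qed
      finally show "(LINT s|lborel. indicator I s * g s) \<le> (g x + e) * r" .
    qed
  qed
qed

text \<open>The one-sided bound, applied to \<open>g\<close> and to \<open>- g\<close>, controls the
  averages over \<open>{x<..x + r}\<close> and \<open>{x - r<..x}\<close> from above and below;
  these averages are the right and left difference quotients of the primitive.\<close>

theorem AE_has_real_derivative_indefinite_integral:
  fixes g :: "real \<Rightarrow> real"
  assumes g: "integrable lborel g"
  shows "AE x in lborel. ((\<lambda>t. LINT s|lborel. indicator {..t} s * g s) has_real_derivative g x) (at x)"
proof -
  let ?F = "\<lambda>t. LINT s|lborel. indicator {..t} s * g s"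
  have int: "integrable lborel (\<lambda>s. indicator I s * g s)" if "I \<in> sets borel" for I
    using integrable_mult_indicator[OF _ g, of I] that by simp
  have diff: "?F v - ?F u = (LINT s|lborel. indicator {u<..v} s * g s)" if "u \<le> v" for u v
    using that by (subst Bochner_Integration.integral_diff[symmetric])
      (auto intro!: int Bochner_Integration.integral_cong split: split_indicator)
  have "AE x in lborel. \<forall>e>0. \<forall>\<^sub>F r in at_right 0. \<forall>I\<in>{{x<..x + r}, {x - r<..x}}.
    (LINT s|lborel. indicator I s * - g s) \<le> (- g x + e) * r"
    using g by (intro AE_eventually_average_le) simp
  with AE_eventually_average_le[OF g] show ?thesis
  proof eventually_elim
    case (elim x)
    show ?case
      unfolding has_field_derivative_iff
    proof (rule tendstoI)
      fix e :: real assume "e > 0"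
      then have e: "e / 2 > 0" by simp
      have "\<forall>\<^sub>F r in at_right 0. \<forall>I\<in>{{x<..x + r}, {x - r<..x}}.
        \<bar>(LINT s|lborel. indicator I s * g s) - g x * r\<bar> \<le> e / 2 * r"
        using elim(1)[rule_format, OF e] elim(2)[rule_format, OF e]
      proof (eventually_elim, intro ballI)
        fix r I assume "\<forall>I\<in>{{x<..x + r}, {x - r<..x}}. (LINT s|lborel. indicator I s * g s) \<le> (g x + e / 2) * r"
          "\<forall>I\<in>{{x<..x + r}, {x - r<..x}}. (LINT s|lborel. indicator I s * - g s) \<le> (- g x + e / 2) * r"
          "I \<in> {{x<..x + r}, {x - r<..x}}"
        then have "(LINT s|lborel. indicator I s * g s) \<le> (g x + e / 2) * r"
          "(LINT s|lborel. indicator I s * - g s) \<le> (- g x + e / 2) * r"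
          by blast+
        then show "\<bar>(LINT s|lborel. indicator I s * g s) - g x * r\<bar> \<le> e / 2 * r"
          unfolding abs_le_iff by (simp add: algebra_simps)
      qed
      then obtain b where b: "b > 0" and *: "\<And>r I. 0 < r \<Longrightarrow> r < b \<Longrightarrow> I \<in> {{x<..x + r}, {x - r<..x}} \<Longrightarrow>
        \<bar>(LINT s|lborel. indicator I s * g s) - g x * r\<bar> \<le> e / 2 * r"
        unfolding eventually_at_right_field by blast
      show "\<forall>\<^sub>F y in at x. dist ((?F y - ?F x) / (y - x)) (g x) < e"
        unfolding eventually_at
      proof (intro exI[of _ b] conjI b ballI impI)
        fix y assume y: "y \<noteq> x \<and> dist y x < b"
        have "\<bar>(?F y - ?F x) - g x * (y - x)\<bar> \<le> e / 2 * \<bar>y - x\<bar>"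
        proof (cases "x < y")
          case True
          then show ?thesis using *[of "y - x" "{x<..y}"] y diff[of x y] by (simp add: dist_real_def)
        next
          case False
          then have "\<bar>(?F x - ?F y) - g x * (x - y)\<bar> \<le> e / 2 * (x - y)"
            using *[of "x - y" "{y<..x}"] y diff[of y x] by (simp add: dist_real_def)
          then show ?thesis using False
            by (subst (1 2) abs_minus_cancel[symmetric]) (simp add: algebra_simps)
        qed
        moreover have eq: "(u / (y - x) - g x) * (y - x) = u - g x * (y - x)" for u
          using y by (simp add: field_simps)
        ultimately have "\<bar>((?F y - ?F x) / (y - x) - g x) * (y - x)\<bar> \<le> e / 2 * \<bar>y - x\<bar>"
          using y eq[of "?F y - ?F x"] by simp
        then have "\<bar>(?F y - ?F x) / (y - x) - g x\<bar> \<le> e / 2"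
          using y by (subst (asm) abs_mult) simp
        then show "dist ((?F y - ?F x) / (y - x)) (g x) < e"
          using \<open>e > 0\<close> by (simp add: dist_real_def)
      qed
    qed
  qed
qed

subsection \<open>Absolutely continuous functions\<close>

text \<open>Truncation: \<open>k m\<close> is \<open>\<bar>h\<bar>\<close> where it exceeds
  \<open>m\<close> and 0 elsewhere, its integral tends to 0 by dominated convergence, and
  \<open>\<bar>h\<bar> \<le> m + k m\<close>. Increments over disjoint intervals therefore sum to at
  most the integral of \<open>k m\<close> plus \<open>m\<close> times the total length.\<close>

lemma absolutely_continuous_on_primitive:
  fixes h F :: "real \<Rightarrow> real"
  assumes h: "integrable lborel h"
    and F: "\<And>t. t \<in> {a..b} \<Longrightarrow> F t = c + (LINT s|lborel. indicator {..t} s * h s)"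
  shows "absolutely_continuous_on a b F"
  unfolding absolutely_continuous_on_def
proof (intro allI impI)
  fix e :: real assume e: "e > 0"
  have [measurable]: "h \<in> borel_measurable borel" using h by auto
  define k where "k n s = indicator {s. real n < \<bar>h s\<bar>} s * \<bar>h s\<bar>" for n :: nat and s
  have k: "integrable lborel (k n)" for n
    unfolding k_def using integrable_mult_indicator[OF _ integrable_abs[OF h], of "{s. real n < \<bar>h s\<bar>}"] by simp
  have "(\<lambda>n. LINT s|lborel. k n s) \<longlonglongrightarrow> integral\<^sup>L lborel (\<lambda>s::real. 0::real)"
  proof (rule integral_dominated_convergence[where w="\<lambda>s. \<bar>h s\<bar>"])
    show "AE s in lborel. (\<lambda>n. k n s) \<longlonglongrightarrow> 0"
    proof (intro AE_I2)
      fix s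
      obtain n0 where "\<bar>h s\<bar> < real n0" using reals_Archimedean2 by blast
      then have "\<forall>n\<ge>n0. k n s = 0" by (auto simp: k_def)
      then show "(\<lambda>n. k n s) \<longlonglongrightarrow> 0" by (intro tendsto_eventually) (auto simp: eventually_sequentially)
    qed
    show "integrable lborel (\<lambda>s. \<bar>h s\<bar>)" using h by simp
  qed (auto simp: k_def indicator_def)
  then have "\<forall>\<^sub>F n in sequentially. (LINT s|lborel. k n s) < e / 2"
    using e by (intro order_tendstoD) auto
  then obtain m where m: "(LINT s|lborel. k m s) < e / 2" by (auto simp: eventually_sequentially)
  show "\<exists>\<delta>>0. \<forall>(n::nat) l r. (\<forall>i<n. a \<le> l i \<and> l i \<le> r i \<and> r i \<le> b) \<longrightarrow>
          disjoint_family_on (\<lambda>i. {l i<..<r i}) {..<n} \<longrightarrow>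
          (\<Sum>i<n. r i - l i) < \<delta> \<longrightarrow> (\<Sum>i<n. dist (F (l i)) (F (r i))) < e"
  \<comment> \<open>The \<open>+ 1\<close> keeps the denominator positive when
    \<open>m = 0\<close>.\<close>
  proof (intro exI[of _ "e / (2 * (real m + 1))"] conjI allI impI)
    fix n :: nat and l r :: "nat \<Rightarrow> real"
    assume lr: "\<forall>i<n. a \<le> l i \<and> l i \<le> r i \<and> r i \<le> b"
      and disj: "disjoint_family_on (\<lambda>i. {l i<..<r i}) {..<n}"
      and small: "(\<Sum>i<n. r i - l i) < e / (2 * (real m + 1))"
    have int: "integrable lborel (\<lambda>s. indicator I s * h s)" if "I \<in> sets borel" for I
      using integrable_mult_indicator[OF _ h, of I] that by simp
    have intk: "integrable lborel (\<lambda>s. indicator I s * k m s)" if "I \<in> sets borel" for I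
      using integrable_mult_indicator[OF _ k, of I] that by simp
    have le: "dist (F (l i)) (F (r i)) \<le> (LINT s|lborel. indicator {l i<..<r i} s * k m s) + real m * (r i - l i)"
      if i: "i < n" for i
    proof -
      have 1: "l i \<in> {a..b}" "r i \<in> {a..b}" "l i \<le> r i" using lr i by force+
      have "dist (F (l i)) (F (r i)) = \<bar>(LINT s|lborel. indicator {..r i} s * h s) - (LINT s|lborel. indicator {..l i} s * h s)\<bar>"
        using 1 by (simp add: F dist_real_def)
      also have "\<dots> = \<bar>LINT s|lborel. indicator {l i<..r i} s * h s\<bar>"
        using 1 by (subst Bochner_Integration.integral_diff[symmetric])
          (auto intro!: int arg_cong[where f=abs] Bochner_Integration.integral_cong split: split_indicator)
      \<comment> \<open>Only the open intervals are assumed disjoint, so the right end point, a null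
        set, is dropped.\<close>
      also have "\<dots> = \<bar>LINT s|lborel. indicator {l i<..<r i} s * h s\<bar>"
      proof -
        have "AE s in lborel. s \<noteq> r i" by (rule AE_lborel_singleton)
        then have "AE s in lborel. indicator {l i<..r i} s * h s = indicator {l i<..<r i} s * h s"
          by eventually_elim (auto simp: indicator_def)
        then show ?thesis by (subst integral_cong_AE) auto
      qed
      also have "\<dots> \<le> (LINT s|lborel. \<bar>indicator {l i<..<r i} s * h s\<bar>)" by (rule integral_abs_bound)
      also have "\<dots> \<le> (LINT s|lborel. indicator {l i<..<r i} s * k m s + real m * indicator {l i<..<r i} s)"
        using 1 by (intro integral_mono integrable_abs int Bochner_Integration.integrable_add intk integrable_mult_right integrable_real_indicator)
          (auto simp: k_def indicator_def)
      also have "\<dots> = (LINT s|lborel. indicator {l i<..<r i} s * k m s) + real m * (r i - l i)"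
        using 1 by (subst Bochner_Integration.integral_add) (auto intro!: intk)
      finally show ?thesis .
    qed
    have "(\<Sum>i<n. dist (F (l i)) (F (r i))) \<le>
      (\<Sum>i<n. LINT s|lborel. indicator {l i<..<r i} s * k m s) + real m * (\<Sum>i<n. r i - l i)"
      using sum_mono[of "{..<n}", OF le] by (simp add: sum.distrib sum_distrib_left)
    also have "(\<Sum>i<n. LINT s|lborel. indicator {l i<..<r i} s * k m s) =
        (LINT s|lborel. (\<Sum>i<n. indicator {l i<..<r i} s * k m s))"
      by (subst Bochner_Integration.integral_sum) (auto intro!: intk)
    also have "\<dots> \<le> (LINT s|lborel. k m s)"
    proof (intro integral_mono k Bochner_Integration.integrable_sum intk)
      fix s
      have "(\<Sum>i<n. indicator {l i<..<r i} s * k m s) = indicator (\<Union>i<n. {l i<..<r i}) s * k m s"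
        using disj by (simp add: indicator_UN_disjoint sum_distrib_right)
      also have "\<dots> \<le> k m s" by (auto simp: k_def indicator_def)
      finally show "(\<Sum>i<n. indicator {l i<..<r i} s * k m s) \<le> k m s" .
    qed auto
    also have "real m * (\<Sum>i<n. r i - l i) \<le> (real m + 1) * (\<Sum>i<n. r i - l i)"
      using lr by (intro mult_right_mono sum_nonneg) auto
    also have "\<dots> < (real m + 1) * (e / (2 * (real m + 1)))" 
      using small by (intro mult_strict_left_mono) auto
    also have "\<dots> = e / 2"
      by (simp add: add_nonneg_eq_0_iff divide_simps)
    finally show "(\<Sum>i<n. dist (F (l i)) (F (r i))) < e" using m by simp
  qed (use e in auto)
qed

section \<open>Finite families of intervals and total variation\<close>

text \<open>Sets of end-point pairs replace the indexed lists of
  \<open>absolutely_continuous_on\<close>, so that families can be cut, extended and merged by set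
  operations. Degenerate intervals are excluded, so that every member contains a point of its open
  interval, and any such point determines the member.\<close>

definition interval_family :: "real \<Rightarrow> real \<Rightarrow> (real \<times> real) set \<Rightarrow> bool"
  where "interval_family a b D \<longleftrightarrow> finite D \<and> (\<forall>p\<in>D. a \<le> fst p \<and> fst p < snd p \<and> snd p \<le> b) \<and>
    disjoint_family_on (\<lambda>p. {fst p<..<snd p}) D"

definition increments :: "(real \<Rightarrow> real) \<Rightarrow> (real \<times> real) set \<Rightarrow> real"
  where "increments g D = (\<Sum>p\<in>D. \<bar>g (snd p) - g (fst p)\<bar>)"

text \<open>A supremum of reals, hence meaningful only for bounded increments;
  \<open>ac_on_families_increments_bounded\<close> provides the bound.\<close>

definition total_variation :: "(real \<Rightarrow> real) \<Rightarrow> real \<Rightarrow> real \<Rightarrow> real"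
  where "total_variation g a b = Sup (increments g ` {D. interval_family a b D})"

definition ac_on_families :: "real \<Rightarrow> real \<Rightarrow> (real \<Rightarrow> real) \<Rightarrow> bool"
  where "ac_on_families a b g \<longleftrightarrow> (\<forall>\<epsilon>>0. \<exists>\<delta>>0. \<forall>D. interval_family a b D \<longrightarrow>
    (\<Sum>p\<in>D. snd p - fst p) < \<delta> \<longrightarrow> increments g D < \<epsilon>)"

lemma interval_familyD:
  assumes "interval_family a b D" "p \<in> D"
  shows "a \<le> fst p" "fst p < snd p" "snd p \<le> b"
  using assms by (auto simp: interval_family_def)

lemma absolutely_continuous_on_imp_ac_on_families:
  assumes "absolutely_continuous_on a b g"
  shows "ac_on_families a b g"
  unfolding ac_on_families_def
proof (intro allI impI)
  fix e :: real assume "e > 0"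
  with assms obtain d where d: "d > 0" and *: "\<And>(n::nat) l r. (\<forall>i<n. a \<le> l i \<and> l i \<le> r i \<and> r i \<le> b) \<Longrightarrow>
       disjoint_family_on (\<lambda>i. {l i<..<r i}) {..<n} \<Longrightarrow>
       (\<Sum>i<n. r i - l i) < d \<Longrightarrow> (\<Sum>i<n. dist (g (l i)) (g (r i))) < e"
    unfolding absolutely_continuous_on_def by blast
  show "\<exists>\<delta>>0. \<forall>D. interval_family a b D \<longrightarrow> (\<Sum>p\<in>D. snd p - fst p) < \<delta> \<longrightarrow> increments g D < e"
  proof (intro exI[of _ d] conjI d allI impI)
    fix D assume D: "interval_family a b D" "(\<Sum>p\<in>D. snd p - fst p) < d"
    then have "finite D" by (auto simp: interval_family_def)
    then obtain h where h: "bij_betw h {..<card D} D"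
      using ex_bij_betw_nat_finite[of D] by (auto simp: atLeast0LessThan)
    have hD: "h i \<in> D" if "i < card D" for i using h that by (auto simp: bij_betw_def)
    have "(\<Sum>i<card D. dist (g (fst (h i))) (g (snd (h i)))) < e"
    proof (rule *)
      show "\<forall>i<card D. a \<le> fst (h i) \<and> fst (h i) \<le> snd (h i) \<and> snd (h i) \<le> b"
        using hD interval_familyD[OF D(1)] by (auto intro: less_imp_le)
      show "disjoint_family_on (\<lambda>i. {fst (h i)<..<snd (h i)}) {..<card D}"
        unfolding disjoint_family_on_def
      proof (intro ballI impI)
        fix i j assume ij: "i \<in> {..<card D}" "j \<in> {..<card D}" "i \<noteq> j"
        then have "h i \<noteq> h j" using h by (auto simp: bij_betw_def dest: inj_onD)
        then show "{fst (h i)<..<snd (h i)} \<inter> {fst (h j)<..<snd (h j)} = {}"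
          using ij hD D(1) unfolding interval_family_def by (intro disjoint_family_onD) auto
      qed
      show "(\<Sum>i<card D. snd (h i) - fst (h i)) < d"
        using D(2) sum.reindex_bij_betw[OF h, of "\<lambda>p. snd p - fst p"] by simp
    qed
    then show "increments g D < e"
      using sum.reindex_bij_betw[OF h, of "\<lambda>p. dist (g (fst p)) (g (snd p))"]
      by (simp add: increments_def dist_real_def abs_minus_commute)
  qed
qed

lemma interval_family_empty:
  assumes "interval_family a b D" "b \<le> a"
  shows "D = {}"
  using interval_familyD[OF assms(1)] assms(2) by (meson all_not_in_conv leD le_less_trans less_le_trans)

lemma interval_family_mono:
  assumes D: "interval_family s t D" and "a \<le> s" "t \<le> b"
  shows "interval_family a b D"
  unfolding interval_family_def
proof (intro conjI ballI)
  fix p assume "p \<in> D"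
  from interval_familyD[OF D this] show "a \<le> fst p" "fst p < snd p" "snd p \<le> b"
    using assms(2,3) by linarith+
qed (use D in \<open>auto simp: interval_family_def\<close>)

lemma interval_family_unique:
  assumes "interval_family a b D" "p \<in> D" "q \<in> D" "x \<in> {fst p<..<snd p}" "x \<in> {fst q<..<snd q}"
  shows "p = q"
proof (rule ccontr)
  assume "p \<noteq> q"
  then have "{fst p<..<snd p} \<inter> {fst q<..<snd q} = {}"
    using assms(1-3) unfolding interval_family_def by (blast dest: disjoint_family_onD)
  then show False using assms(4,5) by blast
qed

lemma interval_family_length:
  assumes D: "interval_family a b D" and U: "U \<in> sets borel" "emeasure lborel U < \<infinity>"
    "\<And>p. p \<in> D \<Longrightarrow> {fst p<..<snd p} \<subseteq> U"
  shows "(\<Sum>p\<in>D. snd p - fst p) \<le> measure lborel U"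
proof -
  have "(\<Sum>p\<in>D. snd p - fst p) = (\<Sum>p\<in>D. measure lborel {fst p<..<snd p})"
    using D by (intro sum.cong) (auto simp: interval_family_def less_imp_le)
  also have "\<dots> = measure lborel (\<Union>p\<in>D. {fst p<..<snd p})"
    using D by (intro measure_finite_Union[symmetric])
      (auto simp: interval_family_def less_imp_le)
  also have "\<dots> \<le> measure lborel U"
    using D U by (intro measure_mono_fmeasurable)
      (auto simp: fmeasurable_def interval_family_def intro!: sets.countable_UN' countable_finite)
  finally show ?thesis .
qed

lemma interval_family_length_le:
  assumes "interval_family a b D" "a \<le> b"
  shows "(\<Sum>p\<in>D. snd p - fst p) \<le> b - a"
proof -
  have "(\<Sum>p\<in>D. snd p - fst p) \<le> measure lborel {a..b}"
  proof (rule interval_family_length[OF assms(1)])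
    fix p assume "p \<in> D"
    from interval_familyD[OF assms(1) this] show "{fst p<..<snd p} \<subseteq> {a..b}" by auto
  qed (use assms(2) in auto)
  then show ?thesis using assms by simp
qed

text \<open>Members on one side of \<open>s\<close> are kept, a member straddling \<open>s\<close>
  is cut there into two, and the triangle inequality through \<open>g s\<close> gives the estimate.
  \<open>L\<close> and \<open>R\<close> truncate at \<open>s\<close>; a straddling member belongs to
  both \<open>DL\<close> and \<open>DR\<close>.\<close>

lemma interval_family_split:
  assumes D: "interval_family a b D" and s: "a \<le> s" "s \<le> b"
  obtains D1 D2 where "interval_family a s D1" "interval_family s b D2"
    "increments g D \<le> increments g D1 + increments g D2"
proof -
  define L where "L p = (fst p, min (snd p) s)" for p :: "real \<times> real"
  define R where "R p = (max (fst p) s, snd p)" for p :: "real \<times> real"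
  define DL where "DL = {p\<in>D. fst p < s}"
  define DR where "DR = {p\<in>D. s < snd p}"
  have fin: "finite D" and lt: "\<And>p. p \<in> D \<Longrightarrow> a \<le> fst p \<and> fst p < snd p \<and> snd p \<le> b"
    using D by (auto simp: interval_family_def)
  have eqL: "p = q" if pq: "p \<in> DL" "q \<in> DL" "{fst (L p)<..<snd (L p)} \<inter> {fst (L q)<..<snd (L q)} \<noteq> {}" for p q
    proof -
    obtain x where "x \<in> {fst (L p)<..<snd (L p)}" "x \<in> {fst (L q)<..<snd (L q)}" using pq(3) by blast
    then show ?thesis using pq(1,2) by (intro interval_family_unique[OF D, of p q x]) (auto simp: DL_def L_def)
  qed
  have eqR: "p = q" if pq: "p \<in> DR" "q \<in> DR" "{fst (R p)<..<snd (R p)} \<inter> {fst (R q)<..<snd (R q)} \<noteq> {}" for p q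
    proof -
    obtain x where "x \<in> {fst (R p)<..<snd (R p)}" "x \<in> {fst (R q)<..<snd (R q)}" using pq(3) by blast
    then show ?thesis using pq(1,2) by (intro interval_family_unique[OF D, of p q x]) (auto simp: DR_def R_def)
  qed
  have neL: "{fst (L p)<..<snd (L p)} \<noteq> {}" if "p \<in> DL" for p
    using that lt[of p] by (auto simp: DL_def L_def)
  have neR: "{fst (R p)<..<snd (R p)} \<noteq> {}" if "p \<in> DR" for p
    using that lt[of p] by (auto simp: DR_def R_def)
  \<comment> \<open>Truncated members are still nonempty, so two with the same image meet and
    therefore coincide.\<close>
  have injL: "inj_on L DL" using eqL neL by (auto intro!: inj_onI)
  have injR: "inj_on R DR" using eqR neR by (auto intro!: inj_onI)
  have FL: "interval_family a s (L ` DL)"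
    unfolding interval_family_def disjoint_family_on_def
  proof (intro conjI ballI impI)
    fix p q assume "p \<in> L ` DL" "q \<in> L ` DL" "p \<noteq> q"
    then show "{fst p<..<snd p} \<inter> {fst q<..<snd q} = {}" using eqL by blast
  qed (use fin lt in \<open>auto simp: DL_def L_def\<close>)
  have FR: "interval_family s b (R ` DR)"
    unfolding interval_family_def disjoint_family_on_def
  proof (intro conjI ballI impI)
    fix p q assume "p \<in> R ` DR" "q \<in> R ` DR" "p \<noteq> q"
    then show "{fst p<..<snd p} \<inter> {fst q<..<snd q} = {}" using eqR by blast
  qed (use fin lt in \<open>auto simp: DR_def R_def\<close>)
  have "increments g D \<le> (\<Sum>p\<in>D. (if fst p < s then \<bar>g (snd (L p)) - g (fst (L p))\<bar> else 0)
      + (if s < snd p then \<bar>g (snd (R p)) - g (fst (R p))\<bar> else 0))"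
    unfolding increments_def
  proof (rule sum_mono)
    fix p assume "p \<in> D"
    then show "\<bar>g (snd p) - g (fst p)\<bar> \<le> (if fst p < s then \<bar>g (snd (L p)) - g (fst (L p))\<bar> else 0)
      + (if s < snd p then \<bar>g (snd (R p)) - g (fst (R p))\<bar> else 0)"
      using lt[of p] by (auto simp: L_def R_def min_def max_def)
  qed
  also have "\<dots> = increments g (L ` DL) + increments g (R ` DR)"
  proof -
    have "(\<Sum>p\<in>D. if fst p < s then \<bar>g (snd (L p)) - g (fst (L p))\<bar> else 0) = increments g (L ` DL)"
      unfolding increments_def by (subst sum.reindex[OF injL]) (use fin in \<open>simp add: DL_def sum.inter_filter\<close>)
    moreover have "(\<Sum>p\<in>D. if s < snd p then \<bar>g (snd (R p)) - g (fst (R p))\<bar> else 0) = increments g (R ` DR)"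
      unfolding increments_def by (subst sum.reindex[OF injR]) (use fin in \<open>simp add: DR_def sum.inter_filter\<close>)
    ultimately show ?thesis by (simp add: sum.distrib)
  qed
  finally show ?thesis using that FL FR by blast
qed

text \<open>With \<open>d\<close> the length that absolute continuity assigns to the tolerance 1,
  each piece of length \<open>d / 2\<close> contributes less than 1, and about
  \<open>(b - a) / (d / 2)\<close> pieces exhaust the interval. The half makes the strict condition
  \<open>< d\<close> hold.\<close>

lemma ac_on_families_increments_bounded:
  assumes g: "ac_on_families a b g"
  obtains C where "\<And>s t D. a \<le> s \<Longrightarrow> t \<le> b \<Longrightarrow> interval_family s t D \<Longrightarrow> increments g D \<le> C"
proof -
  obtain d where d: "d > 0" and *: "\<And>D. interval_family a b D \<Longrightarrow> (\<Sum>p\<in>D. snd p - fst p) < d \<Longrightarrow> increments g D < 1"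
    using g[unfolded ac_on_families_def, rule_format, of 1] by auto
  have "increments g D \<le> real n" if "interval_family s t D" "a \<le> s" "t \<le> b" "t - s \<le> real n * (d / 2)" for n s t D
    using that
  proof (induction n arbitrary: t D)
    case 0
    then have "D = {}" using interval_family_empty[of s t D] by simp
    then show ?case by (simp add: increments_def)
  next
    case (Suc n)
    show ?case
    proof (cases "s \<le> t")
      case False
      with Suc.prems(1) have "D = {}" using interval_family_empty[of s t D] by simp
      then show ?thesis by (simp add: increments_def)
    next
      case True
      \<comment> \<open>The last piece, of length at most \<open>d / 2\<close>, is split off at the
        right; \<open>max s\<close> covers the case that less than this remains.\<close>
      define u where "u = max s (t - d / 2)"
      have u: "s \<le> u" "u \<le> t" "t - u < d" "u - s \<le> real n * (d / 2)"
      proof -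
        have "u - s \<le> real n * (d / 2)"
        proof (cases "s \<le> t - d / 2")
          case True
          then show ?thesis using Suc.prems(4) by (simp add: u_def distrib_right)
        qed (use d in \<open>simp add: u_def\<close>)
        then show "s \<le> u" "u \<le> t" "t - u < d" "u - s \<le> real n * (d / 2)"
          using True d by (auto simp: u_def)
      qed
      obtain D1 D2 where D: "interval_family s u D1" "interval_family u t D2"
          "increments g D \<le> increments g D1 + increments g D2"
        using interval_family_split[OF Suc.prems(1) u(1,2)] by blast
      have "increments g D1 \<le> real n" using Suc.IH[OF D(1) Suc.prems(2) _ u(4)] Suc.prems(3) u(2) by linarith
      moreover have "increments g D2 < 1"
      proof (rule *)
        show "interval_family a b D2" using interval_family_mono[OF D(2), of a b] Suc.prems(2,3) u(1) by auto
        show "(\<Sum>p\<in>D2. snd p - fst p) < d" using interval_family_length_le[OF D(2) u(2)] u(3) by simp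
      qed
      ultimately show ?thesis using D(3) by simp
    qed
  qed
  note bound = this
  obtain n where "(b - a) / (d / 2) \<le> real n" using real_arch_simple by blast
  then have "b - a \<le> real n * (d / 2)" using d by (simp add: field_simps)
  then have "increments g D \<le> real n" if "a \<le> s" "t \<le> b" "interval_family s t D" for s t D
  proof -
    have "t - s \<le> b - a" using that(1,2) by simp
    then have "t - s \<le> real n * (d / 2)" using \<open>b - a \<le> real n * (d / 2)\<close> by linarith
    then show ?thesis using bound that by blast
  qed
  then show ?thesis using that by blast
qed

context
  fixes a b :: real and g :: "real \<Rightarrow> real"
  assumes g: "ac_on_families a b g"
begin

lemma increments_le_total_variation:
  assumes "a \<le> s" "t \<le> b" "interval_family s t D"
  shows "increments g D \<le> total_variation g s t"
proof -
  obtain C where "\<And>s t D. a \<le> s \<Longrightarrow> t \<le> b \<Longrightarrow> interval_family s t D \<Longrightarrow> increments g D \<le> C"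
    using ac_on_families_increments_bounded[OF g] by blast
  then show ?thesis unfolding total_variation_def using assms
    by (intro cSup_upper bdd_aboveI[of _ C]) auto
qed

lemma total_variation_leI:
  assumes "\<And>D. interval_family s t D \<Longrightarrow> increments g D \<le> C"
  shows "total_variation g s t \<le> C"
proof -
  have "interval_family s t {}" by (simp add: interval_family_def disjoint_family_on_def)
  then show ?thesis unfolding total_variation_def using assms by (intro cSup_least) auto
qed

text \<open>Any family in \<open>[a, s]\<close> may be enlarged by the pair \<open>(s, t)\<close>.
  Consequently the variation and the variation minus \<open>g\<close> are both nondecreasing, which
  is the Jordan decomposition.\<close>

lemma total_variation_ge_increment:
  assumes st: "a \<le> s" "s \<le> t" "t \<le> b"
  shows "total_variation g a s + \<bar>g t - g s\<bar> \<le> total_variation g a t"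
proof -
  have "total_variation g a s \<le> total_variation g a t - \<bar>g t - g s\<bar>"
  proof (rule total_variation_leI)
    fix D assume D: "interval_family a s D"
    show "increments g D \<le> total_variation g a t - \<bar>g t - g s\<bar>"
    \<comment> \<open>A degenerate pair may not join a family, so \<open>s = t\<close> is treated
      apart.\<close>
    proof (cases "s = t")
      case True
      then show ?thesis using increments_le_total_variation[of a s D] D st by simp
    next
      case False
      have n: "(s, t) \<notin> D" using interval_familyD[OF D, of "(s, t)"] False st by auto
      have "interval_family a t (insert (s, t) D)"
        unfolding interval_family_def
      proof (intro conjI)
        have "{fst p<..<snd p} \<inter> {s<..<t} = {}" if "p \<in> D" for p
          using D that by (auto simp: interval_family_def)
        then show "disjoint_family_on (\<lambda>p. {fst p<..<snd p}) (insert (s, t) D)"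
          using D n by (subst disjoint_family_on_insert) (auto simp: interval_family_def)
      qed (use D False st in \<open>auto simp: interval_family_def\<close>)
      then have "increments g (insert (s, t) D) \<le> total_variation g a t"
        using st by (intro increments_le_total_variation) auto
      then show ?thesis using n D by (simp add: increments_def interval_family_def)
    qed
  qed
  then show ?thesis by simp
qed

lemma total_variation_subadditive:
  assumes st: "a \<le> s" "s \<le> t" "t \<le> b"
  shows "total_variation g a t \<le> total_variation g a s + total_variation g s t"
proof (rule total_variation_leI)
  fix D assume D: "interval_family a t D"
  obtain D1 D2 where "interval_family a s D1" "interval_family s t D2"
    "increments g D \<le> increments g D1 + increments g D2"
    using interval_family_split[OF D st(1,2)] by blast
  then show "increments g D \<le> total_variation g a s + total_variation g s t"
    using increments_le_total_variation[of a s D1] increments_le_total_variation[of s t D2] st by auto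
qed

text \<open>Each member \<open>p\<close> of \<open>D\<close> is refined by a family
  \<open>E p\<close> inside it that nearly attains the variation over \<open>p\<close>. The union of
  these families has total length at most that of \<open>D\<close>, so absolute continuity of
  \<open>g\<close> applies to it; subadditivity bounds the increment of the variation across
  \<open>p\<close> by the variation over \<open>p\<close>.\<close>

lemma ac_on_families_total_variation: "ac_on_families a b (total_variation g a)"
  unfolding ac_on_families_def
proof (intro allI impI)
  fix e :: real assume e: "e > 0"
  obtain d where d: "d > 0" and *: "\<And>D. interval_family a b D \<Longrightarrow> (\<Sum>p\<in>D. snd p - fst p) < d \<Longrightarrow> increments g D < e / 2"
    using g[unfolded ac_on_families_def, rule_format, of "e / 2"] e by auto
  show "\<exists>\<delta>>0. \<forall>D. interval_family a b D \<longrightarrow> (\<Sum>p\<in>D. snd p - fst p) < \<delta> \<longrightarrow> increments (total_variation g a) D < e"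
  proof (intro exI[of _ d] conjI d allI impI)
    fix D assume D: "interval_family a b D" "(\<Sum>p\<in>D. snd p - fst p) < d"
    have fin: "finite D" and lt: "\<And>p. p \<in> D \<Longrightarrow> a \<le> fst p \<and> fst p < snd p \<and> snd p \<le> b"
      using D by (auto simp: interval_family_def)
    \<comment> \<open>The \<open>card D\<close> approximation errors add up to at most
      \<open>e / 2\<close>; the \<open>+ 1\<close> covers the empty family.\<close>
    define \<eta> where "\<eta> = e / (2 * (real (card D) + 1))"
    have \<eta>: "\<eta> > 0" using e by (simp add: \<eta>_def)
    have "\<forall>p\<in>D. \<exists>E. interval_family (fst p) (snd p) E \<and> total_variation g (fst p) (snd p) \<le> increments g E + \<eta>"
    proof
      fix p assume "p \<in> D"
      show "\<exists>E. interval_family (fst p) (snd p) E \<and> total_variation g (fst p) (snd p) \<le> increments g E + \<eta>"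
      proof (rule ccontr)
        assume "\<not> ?thesis"
        then have "total_variation g (fst p) (snd p) \<le> total_variation g (fst p) (snd p) - \<eta>"
          by (intro total_variation_leI) force
        then show False using \<eta> by simp
      qed
    qed
    then obtain E where E: "\<And>p. p \<in> D \<Longrightarrow> interval_family (fst p) (snd p) (E p)"
      "\<And>p. p \<in> D \<Longrightarrow> total_variation g (fst p) (snd p) \<le> increments g (E p) + \<eta>"
      using bchoice[of D "\<lambda>p E. interval_family (fst p) (snd p) E \<and> total_variation g (fst p) (snd p) \<le> increments g E + \<eta>"] by blast
    have finE: "finite (E p)" if "p \<in> D" for p using E(1)[OF that] by (simp add: interval_family_def)
    have inside: "{fst q<..<snd q} \<subseteq> {fst p<..<snd p}" "fst q < snd q" "fst p \<le> fst q" "snd q \<le> snd p" if "p \<in> D" "q \<in> E p" for p q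
      proof -
      show 1: "fst q < snd q" "fst p \<le> fst q" "snd q \<le> snd p"
        using E(1)[OF that(1)] that(2) unfolding interval_family_def by blast+
      show "{fst q<..<snd q} \<subseteq> {fst p<..<snd p}" using 1 by auto
    qed
    have same: "p = p'" if "p \<in> D" "p' \<in> D" "q \<in> E p" "q' \<in> E p'" "x \<in> {fst q<..<snd q}" "x \<in> {fst q'<..<snd q'}" for p p' q q' x
      using that inside(1) interval_family_unique[OF D(1), of p p' x] by blast
    \<comment> \<open>Sums over the union split only if no pair is shared: one lying in two of the
      families would be counted once.\<close>
    have disjE: "E p \<inter> E p' = {}" if "p \<in> D" "p' \<in> D" "p \<noteq> p'" for p p'
    proof (rule ccontr)
      assume "\<not> ?thesis"
      then obtain q where q: "q \<in> E p" "q \<in> E p'" by blast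
      then have "(fst q + snd q) / 2 \<in> {fst q<..<snd q}" using inside(2)[of p q] that by auto
      then show False using same[of p p' q q] q that by blast
    qed
    have un: "interval_family a b (\<Union>p\<in>D. E p)"
      unfolding interval_family_def disjoint_family_on_def
    proof (intro conjI ballI impI)
      show "finite (\<Union>p\<in>D. E p)" using fin finE by blast
      fix q assume "q \<in> (\<Union>p\<in>D. E p)"
      then obtain p where p: "p \<in> D" "q \<in> E p" by blast
      show "a \<le> fst q" "fst q < snd q" "snd q \<le> b" using inside[OF p] lt[OF p(1)] by auto
      fix q' assume "q' \<in> (\<Union>p\<in>D. E p)" "q \<noteq> q'"
      then obtain p' where p': "p' \<in> D" "q' \<in> E p'" by blast
      show "{fst q<..<snd q} \<inter> {fst q'<..<snd q'} = {}"
      proof (rule ccontr)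
        assume "\<not> ?thesis"
        then obtain x where x: "x \<in> {fst q<..<snd q}" "x \<in> {fst q'<..<snd q'}" by blast
        then have "p = p'" using same p p' by blast
        then show False using x interval_family_unique[OF E(1)[OF p(1)], of q q' x] p p' \<open>q \<noteq> q'\<close> by blast
      qed
    qed
    have "(\<Sum>q\<in>(\<Union>p\<in>D. E p). snd q - fst q) = (\<Sum>p\<in>D. \<Sum>q\<in>E p. snd q - fst q)"
      using fin finE disjE by (intro sum.UNION_disjoint) auto
    also have "\<dots> \<le> (\<Sum>p\<in>D. snd p - fst p)"
      using E(1) lt by (intro sum_mono interval_family_length_le) (auto simp: less_imp_le)
    also have "\<dots> < d" by fact
    finally have "increments g (\<Union>p\<in>D. E p) < e / 2" by (intro * un)
    also have "increments g (\<Union>p\<in>D. E p) = (\<Sum>p\<in>D. increments g (E p))"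
      unfolding increments_def using fin finE disjE by (intro sum.UNION_disjoint) auto
    finally have small: "(\<Sum>p\<in>D. increments g (E p)) < e / 2" .
    have "increments (total_variation g a) D \<le> (\<Sum>p\<in>D. increments g (E p) + \<eta>)"
      unfolding increments_def[of "total_variation g a"]
    proof (rule sum_mono)
      fix p assume p: "p \<in> D"
      have "total_variation g a (fst p) + \<bar>g (snd p) - g (fst p)\<bar> \<le> total_variation g a (snd p)"
        "total_variation g a (snd p) \<le> total_variation g a (fst p) + total_variation g (fst p) (snd p)"
        using lt[OF p] by (auto intro!: total_variation_ge_increment total_variation_subadditive)
      then show "\<bar>total_variation g a (snd p) - total_variation g a (fst p)\<bar> \<le> increments g (E p) + \<eta>"
        using E(2)[OF p] by linarith
    qed
    also have "\<dots> = (\<Sum>p\<in>D. increments g (E p)) + real (card D) * \<eta>" by (simp add: sum.distrib)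
    also have "real (card D) * \<eta> \<le> e / 2" using e by (simp add: \<eta>_def field_simps)
    finally show "increments (total_variation g a) D < e" using small by simp
  qed
qed

end

lemma ac_on_families_diff:
  assumes "ac_on_families a b f" "ac_on_families a b g"
  shows "ac_on_families a b (\<lambda>t. f t - g t)"
  unfolding ac_on_families_def
proof (intro allI impI)
  fix e :: real assume e: "e > 0"
  obtain d where d: "d > 0" "\<And>D. interval_family a b D \<Longrightarrow> (\<Sum>p\<in>D. snd p - fst p) < d \<Longrightarrow> increments f D < e / 2"
    using assms(1)[unfolded ac_on_families_def, rule_format, of "e / 2"] e by auto
  obtain d' where d': "d' > 0" "\<And>D. interval_family a b D \<Longrightarrow> (\<Sum>p\<in>D. snd p - fst p) < d' \<Longrightarrow> increments g D < e / 2"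
    using assms(2)[unfolded ac_on_families_def, rule_format, of "e / 2"] e by auto
  have "increments (\<lambda>t. f t - g t) D \<le> increments f D + increments g D" for D
    unfolding increments_def sum.distrib[symmetric] by (rule sum_mono) linarith
  moreover have "increments f D + increments g D < e"
    if "interval_family a b D" "(\<Sum>p\<in>D. snd p - fst p) < min d d'" for D
    using d(2)[OF that(1)] d'(2)[OF that(1)] that(2) by simp
  ultimately show "\<exists>\<delta>>0. \<forall>D. interval_family a b D \<longrightarrow> (\<Sum>p\<in>D. snd p - fst p) < \<delta> \<longrightarrow> increments (\<lambda>t. f t - g t) D < e"
    using d(1) d'(1) by (intro exI[of _ "min d d'"]) (auto intro: le_less_trans)
qed

lemma ac_on_families_imp_continuous_on:
  assumes g: "ac_on_families a b g"
  shows "continuous_on {a..b} g"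
  unfolding continuous_on_iff
proof (intro ballI allI impI)
  fix x e :: real assume x: "x \<in> {a..b}" and e: "e > 0"
  obtain d where d: "d > 0" and *: "\<And>D. interval_family a b D \<Longrightarrow> (\<Sum>p\<in>D. snd p - fst p) < d \<Longrightarrow> increments g D < e"
    using g[unfolded ac_on_families_def, rule_format, of e] e by auto
  have "dist (g x') (g x) < e" if x': "x' \<in> {a..b}" "dist x' x < d" for x'
  proof (cases "x' = x")
    case False
    define p where "p = (min x x', max x x')"
    have "interval_family a b {p}"
      using False x x' by (auto simp: p_def interval_family_def disjoint_family_on_def)
    moreover have "(\<Sum>p\<in>{p}. snd p - fst p) < d"
      using x' by (auto simp: p_def dist_real_def min_def max_def)
    ultimately have "increments g {p} < e" by (rule *)
    then show ?thesis by (auto simp: p_def increments_def dist_real_def min_def max_def abs_minus_commute split: if_splits)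
  qed (use e in simp)
  then show "\<exists>d>0. \<forall>x'\<in>{a..b}. dist x' x < d \<longrightarrow> dist (g x') (g x) < e" using d by blast
qed

section \<open>Densities of monotone absolutely continuous functions\<close>

text \<open>Continuity from below along the initial segments of an enumeration of \<open>P\<close>.
  Absolute continuity bounds finite families only; this carries the bound to a countable
  cover.\<close>

lemma emeasure_countable_UN_le:
  assumes P: "countable P" and B: "\<And>p. p \<in> P \<Longrightarrow> B p \<in> sets M"
    and le: "\<And>F. finite F \<Longrightarrow> F \<subseteq> P \<Longrightarrow> emeasure M (\<Union>p\<in>F. B p) \<le> C"
  shows "emeasure M (\<Union>p\<in>P. B p) \<le> C"
proof (cases "P = {}")
  case False
  let ?f = "from_nat_into P"
  define A where "A n = (\<Union>p\<in>?f ` {..<n}. B p)" for n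
  have f: "?f n \<in> P" for n using False by (rule from_nat_into)
  have "(\<Union>p\<in>P. B p) = (\<Union>n. A n)"
  proof -
    have "(\<Union>p\<in>P. B p) = (\<Union>p\<in>range ?f. B p)" by (simp only: range_from_nat_into[OF False P])
    then show ?thesis by (auto simp: A_def)
  qed
  also have "emeasure M \<dots> = (SUP n. emeasure M (A n))"
  proof (intro SUP_emeasure_incseq[symmetric])
    show "incseq A" unfolding A_def by (intro monoI UN_mono image_mono) auto
  qed (use f B in \<open>auto simp: A_def intro!: sets.finite_UN\<close>)
  also have "\<dots> \<le> C" unfolding A_def using f by (intro SUP_least le) auto
  finally show ?thesis .
qed simp

text \<open>A Lebesgue null set in \<open>(a, b]\<close> lies in an open set of measure below
  \<open>d\<close>, and is covered by countably many nonoverlapping closed intervals inside that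
  set. The Stieltjes mass of finitely many of them is at most the sum of the increments of
  \<open>G\<close>, which absolute continuity keeps below \<open>e\<close>. So the Stieltjes measure
  is absolutely continuous, and its Radon-Nikodym density yields \<open>h\<close>.\<close>

lemma mono_ac_on_families_density:
  fixes G :: "real \<Rightarrow> real"
  assumes ab: "a < b" and ac: "ac_on_families a b G" and mono: "mono_on {a..b} G"
  obtains h where "integrable lborel h"
    "\<And>t. t \<in> {a..b} \<Longrightarrow> G t = G a + (LINT s|lborel. indicator {..t} s * h s)"
proof -
  \<comment> \<open>Constant continuation beyond \<open>[a, b]\<close>: the facts on
    \<open>interval_measure\<close> used here ask for monotonicity and continuity on the whole
    line.\<close>
  define F where "F x = G (max a (min b x))" for x
  have F_mono: "F x \<le> F y" if "x \<le> y" for x y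
    unfolding F_def using that ab by (intro mono_onD[OF mono]) auto
  have F_cont: "continuous_on UNIV F"
    unfolding F_def using ab
    by (intro continuous_on_compose2[OF ac_on_families_imp_continuous_on[OF ac]] continuous_intros) auto
  have F_eq: "F x = G x" if "x \<in> {a..b}" for x using that by (simp add: F_def)
  define \<mu> where "\<mu> = interval_measure F"
  have [simp]: "sets \<mu> = sets borel" "space \<mu> = UNIV" by (simp_all add: \<mu>_def)
  have Ioc: "emeasure \<mu> {x<..y} = F y - F x" if "x \<le> y" for x y
    unfolding \<mu>_def using F_mono F_cont that
    by (intro emeasure_interval_measure_Ioc) (auto simp: continuous_on_eq_continuous_within intro: continuous_at_imp_continuous_within)
  have Icc: "emeasure \<mu> {x..y} = F y - F x" if "x \<le> y" for x y
    unfolding \<mu>_def using F_mono F_cont that by (intro emeasure_interval_measure_Icc) auto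
  \<comment> \<open>Restriction to \<open>(a, b]\<close> confines null sets to the box in which the
    covering lemma works.\<close>
  define N where "N = density \<mu> (indicator {a<..b})"
  have N: "emeasure N A = emeasure \<mu> (A \<inter> {a<..b})" if "A \<in> sets borel" for A
  proof -
    have [measurable]: "(indicator {a<..b} :: real \<Rightarrow> ennreal) \<in> borel_measurable \<mu>"
      by (intro borel_measurable_indicator) simp
    show ?thesis unfolding N_def using that
      by (subst emeasure_density) (simp_all add: indicator_inter_arith[symmetric] Int_commute)
  qed
  have "absolutely_continuous lborel N"
    unfolding absolutely_continuous_def
  proof
    fix A :: "real set" assume A: "A \<in> null_sets lborel"
    define S where "S = A \<inter> {a<..b}"
    have S: "S \<in> sets borel" "emeasure lborel S = 0"
      using A null_set_Int2[of A lborel "{a<..b}"] by (auto simp: S_def)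
    have "emeasure \<mu> S \<le> ennreal e" if e: "e > 0" for e
    proof -
      obtain d where d: "d > 0" and *: "\<And>D. interval_family a b D \<Longrightarrow> (\<Sum>p\<in>D. snd p - fst p) < d \<Longrightarrow> increments G D < e"
        using ac[unfolded ac_on_families_def, rule_format, of e] e by auto
      obtain U where U: "open U" "S \<subseteq> U" "emeasure lborel (U - S) < ennreal d"
        using outer_regular_lborel[OF S(1), of d] d by auto
      have Ud: "emeasure lborel U < ennreal d"
      proof -
        have "emeasure lborel U \<le> emeasure lborel S + emeasure lborel (U - S)"
          using U S by (intro order.trans[OF emeasure_mono emeasure_subadditive]) auto
        then show ?thesis using U(3) S(2) by simp
      qed
      \<comment> \<open>A gauge assigns an open neighbourhood to every point; on \<open>S\<close> it
        is \<open>U\<close>, so the boxes of the covering lemma, each tagged by a point of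
        \<open>S\<close>, lie in \<open>U\<close>.\<close>
      have g: "gauge (\<lambda>x. if x \<in> S then U else UNIV)"
        using U(1,2) by (auto simp: gauge_def)
      have S': "S \<subseteq> cbox a b" and box: "box a b \<noteq> {}" using ab by (auto simp: S_def)
      obtain \<D> where \<D>: "countable \<D>" "\<Union>\<D> \<subseteq> cbox a b"
        "\<And>K. K \<in> \<D> \<Longrightarrow> interior K \<noteq> {} \<and> (\<exists>c d. K = cbox c d)"
        "pairwise (\<lambda>A B. interior A \<inter> interior B = {}) \<D>"
        "\<And>K. K \<in> \<D> \<Longrightarrow> \<exists>x \<in> S \<inter> K. K \<subseteq> (if x \<in> S then U else UNIV)"
        "\<And>u v. cbox u v \<in> \<D> \<Longrightarrow> \<exists>n. \<forall>i\<in>Basis. v \<bullet> i - u \<bullet> i = (b \<bullet> i - a \<bullet> i) / 2 ^ n"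
        "S \<subseteq> \<Union>\<D>"
        by (rule covering_lemma[OF S' box g]) (rule that)
      define P where "P = {p. fst p < snd p \<and> {fst p..snd p} \<in> \<D>}"
      have inj: "inj_on (\<lambda>p. {fst p..snd p}) P"
        by (auto simp: inj_on_def P_def Icc_eq_Icc prod_eq_iff)
      have "countable P"
        by (rule countable_image_inj_on[OF countable_subset[OF _ \<D>(1)] inj]) (auto simp: P_def)
      moreover have "S \<subseteq> (\<Union>p\<in>P. {fst p..snd p})"
      proof
        fix x assume "x \<in> S"
        then obtain K where K: "K \<in> \<D>" "x \<in> K" using \<D>(7) by blast
        then obtain c d where cd: "K = {c..d}" "interior K \<noteq> {}" using \<D>(3)[OF K(1)] by (auto simp: cbox_interval)
        then have "(c, d) \<in> P" using K(1) by (simp add: P_def)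
        then show "x \<in> (\<Union>p\<in>P. {fst p..snd p})" using K(2) cd(1) by (intro UN_I[of "(c, d)"]) auto
      qed
      moreover have "emeasure \<mu> (\<Union>p\<in>D. {fst p..snd p}) \<le> ennreal e" if D: "finite D" "D \<subseteq> P" for D
      proof -
        have fam: "interval_family a b D"
          unfolding interval_family_def disjoint_family_on_def
        proof (intro conjI ballI impI D(1))
          fix p assume p: "p \<in> D"
          then have p': "fst p < snd p" "{fst p..snd p} \<in> \<D>" using D by (auto simp: P_def)
          then have sub: "{fst p..snd p} \<subseteq> cbox a b" using \<D>(2) by blast
          show "a \<le> fst p" "fst p < snd p" "snd p \<le> b"
            using subsetD[OF sub, of "fst p"] subsetD[OF sub, of "snd p"] p'(1) by auto
          fix q assume q: "q \<in> D" "p \<noteq> q"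
          have "{fst q..snd q} \<in> \<D>" using q(1) D(2) by (auto simp: P_def)
          moreover have "{fst p..snd p} \<noteq> {fst q..snd q}" using inj_onD[OF inj, of p q] p q D(2) by blast
          ultimately have "interior {fst p..snd p} \<inter> interior {fst q..snd q} = {}"
            using pairwiseD[OF \<D>(4)] p'(2) by blast
          then show "{fst p<..<snd p} \<inter> {fst q<..<snd q} = {}" by simp
        qed
        have "(\<Sum>p\<in>D. snd p - fst p) \<le> measure lborel U"
        proof (rule interval_family_length[OF fam])
          show "emeasure lborel U < \<infinity>" using less_trans[OF Ud ennreal_less_top] by simp
          fix p assume "p \<in> D"
          then have "{fst p..snd p} \<in> \<D>" using D by (auto simp: P_def)
          from \<D>(5)[OF this] show "{fst p<..<snd p} \<subseteq> U"
            using greaterThanLessThan_subseteq_atLeastAtMost_iff by (auto simp: subset_eq)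
        qed (use U(1) in simp)
        also have "\<dots> < d"
          using Ud d by (simp add: measure_def) (metis enn2real_ennreal enn2real_less_iff ennreal_less_top less_imp_le less_trans)
        finally have inc: "increments G D < e" by (rule *[OF fam])
        have "emeasure \<mu> (\<Union>p\<in>D. {fst p..snd p}) \<le> (\<Sum>p\<in>D. emeasure \<mu> {fst p..snd p})"
          using D by (intro emeasure_subadditive_finite) auto
        also have "\<dots> = (\<Sum>p\<in>D. ennreal \<bar>G (snd p) - G (fst p)\<bar>)"
        proof (rule sum.cong[OF refl])
          fix p assume p: "p \<in> D"
          note p = interval_familyD[OF fam p]
          then show "emeasure \<mu> {fst p..snd p} = ennreal \<bar>G (snd p) - G (fst p)\<bar>"
            using F_mono[of "fst p" "snd p"] by (simp add: Icc F_eq)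
        qed
        also have "\<dots> = ennreal (increments G D)" by (simp add: increments_def)
        finally show ?thesis using inc by (meson ennreal_leI less_imp_le order_trans)
      qed
      ultimately have P: "countable P" "S \<subseteq> (\<Union>p\<in>P. {fst p..snd p})"
        "\<And>D. finite D \<Longrightarrow> D \<subseteq> P \<Longrightarrow> emeasure \<mu> (\<Union>p\<in>D. {fst p..snd p}) \<le> ennreal e"
        by blast+
      have "emeasure \<mu> S \<le> emeasure \<mu> (\<Union>p\<in>P. {fst p..snd p})"
        using P(2) by (rule emeasure_mono) (use P(1) in \<open>auto intro!: sets.countable_UN'\<close>)
      also have "\<dots> \<le> ennreal e"
        by (rule emeasure_countable_UN_le[OF P(1) _ P(3)]) auto
      finally show ?thesis .
    qed
    note small = this
    have "emeasure \<mu> S \<le> 0" by (rule ennreal_le_epsilon) (simp add: small)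
    then have "emeasure N A = 0" using A N[of A] by (auto simp: S_def)
    then moreover have "A \<in> sets N" using A by (auto simp: N_def)
    ultimately show "A \<in> null_sets N" by (rule null_setsI)
  qed
  then obtain f where f [measurable]: "f \<in> borel_measurable lborel" and fN: "density lborel f = N"
    using sigma_finite_measure.Radon_Nikodym[OF sigma_finite_lborel, of N] by (auto simp: N_def)
  have fin: "(\<integral>\<^sup>+s. f s \<partial>lborel) = F b - F a"
  proof -
    have "(\<integral>\<^sup>+s. f s \<partial>lborel) = emeasure N UNIV"
      unfolding fN[symmetric] by (simp add: emeasure_density)
    then show ?thesis using ab by (simp add: N Ioc)
  qed
  \<comment> \<open>The total mass is finite, so the density is finite almost everywhere and may be
    replaced by a real function.\<close>
  have fe: "AE s in lborel. f s = ennreal (enn2real (f s))"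
  proof -
    have "AE s in lborel. f s \<noteq> \<infinity>" by (rule nn_integral_noteq_infinite) (auto simp: fin)
    then show ?thesis by eventually_elim (simp add: less_top)
  qed
  define h where "h s = enn2real (f s)" for s
  have [measurable]: "h \<in> borel_measurable lborel" unfolding h_def by measurable
  have int: "integrable lborel h"
  proof (rule integrableI_bounded)
    have "(\<integral>\<^sup>+s. ennreal (norm (h s)) \<partial>lborel) = (\<integral>\<^sup>+s. f s \<partial>lborel)"
      using fe by (intro nn_integral_cong_AE) (auto simp: h_def elim!: eventually_mono)
    then show "(\<integral>\<^sup>+s. ennreal (norm (h s)) \<partial>lborel) < \<infinity>" by (simp add: fin)
  qed simp
  show thesis
  proof (rule that[OF int])
    fix t assume t: "t \<in> {a..b}"
    have "(LINT s|lborel. indicator {..t} s * h s) = enn2real (\<integral>\<^sup>+s. indicator {..t} s * h s \<partial>lborel)"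
      by (subst integral_eq_nn_integral) (auto simp: h_def)
    also have "(\<integral>\<^sup>+s. indicator {..t} s * h s \<partial>lborel) = (\<integral>\<^sup>+s. f s * indicator {..t} s \<partial>lborel)"
      using fe by (intro nn_integral_cong_AE) (auto simp: h_def ennreal_mult ennreal_indicator mult.commute elim!: eventually_mono split: split_indicator)
    also have "\<dots> = emeasure N {..t}"
      unfolding fN[symmetric] by (simp add: emeasure_density)
    also have "\<dots> = emeasure \<mu> {a<..t}"
    proof -
      have "{..t} \<inter> {a<..b} = {a<..t}" using t by auto
      then show ?thesis by (simp add: N)
    qed
    also have "\<dots> = ennreal (G t - G a)" using t ab by (simp add: Ioc F_eq)
    finally show "G t = G a + (LINT s|lborel. indicator {..t} s * h s)"
      using t ab mono_onD[OF mono, of a t] by simp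
  qed
qed

theorem absolutely_continuous_on_imp_primitive:
  fixes g :: "real \<Rightarrow> real"
  assumes ab: "a < b" and g: "absolutely_continuous_on a b g"
  obtains h where "integrable lborel h"
    "\<And>t. t \<in> {a..b} \<Longrightarrow> g t = g a + (LINT s|lborel. indicator {..t} s * h s)"
proof -
  let ?V = "total_variation g a"
  have ac: "ac_on_families a b g" using g by (rule absolutely_continuous_on_imp_ac_on_families)
  have acV: "ac_on_families a b ?V" by (rule ac_on_families_total_variation[OF ac])
  have V: "?V s + \<bar>g t - g s\<bar> \<le> ?V t" if "a \<le> s" "s \<le> t" "t \<le> b" for s t
    by (rule total_variation_ge_increment[OF ac that])
  have "mono_on {a..b} ?V"
  proof (rule mono_onI)
    fix s t assume "s \<in> {a..b}" "t \<in> {a..b}" "s \<le> t"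
    then show "?V s \<le> ?V t" using V[of s t] by auto
  qed
  then obtain h1 where h1: "integrable lborel h1"
    "\<And>t. t \<in> {a..b} \<Longrightarrow> ?V t = ?V a + (LINT s|lborel. indicator {..t} s * h1 s)"
    using mono_ac_on_families_density[OF ab acV] by blast
  have "mono_on {a..b} (\<lambda>t. ?V t - g t)"
  proof (rule mono_onI)
    fix s t assume "s \<in> {a..b}" "t \<in> {a..b}" "s \<le> t"
    then show "?V s - g s \<le> ?V t - g t" using V[of s t] by auto
  qed
  then obtain h2 where h2: "integrable lborel h2"
    "\<And>t. t \<in> {a..b} \<Longrightarrow> ?V t - g t = ?V a - g a + (LINT s|lborel. indicator {..t} s * h2 s)"
    using mono_ac_on_families_density[OF ab ac_on_families_diff[OF acV ac]] by blast
  have int: "integrable lborel (\<lambda>s. indicator I s * h s)" if "I \<in> sets borel" "integrable lborel h" for I and h :: "real \<Rightarrow> real"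
    using integrable_mult_indicator[of I lborel h] that by simp
  show thesis
  proof (rule that[of "\<lambda>s. h1 s - h2 s"])
    fix t assume "t \<in> {a..b}"
    then have t: "?V t = ?V a + (LINT s|lborel. indicator {..t} s * h1 s)"
      "?V t - g t = ?V a - g a + (LINT s|lborel. indicator {..t} s * h2 s)"
      using h1(2) h2(2) by blast+
    have "(LINT s|lborel. indicator {..t} s * (h1 s - h2 s)) =
        (LINT s|lborel. indicator {..t} s * h1 s) - (LINT s|lborel. indicator {..t} s * h2 s)"
      using Bochner_Integration.integral_diff[OF int[OF _ h1(1)] int[OF _ h2(1)], of "{..t}" "{..t}"]
      by (simp add: right_diff_distrib)
    then show "g t = g a + (LINT s|lborel. indicator {..t} s * (h1 s - h2 s))"
      using t by linarith
  qed (use h1(1) h2(1) in simp)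
qed

lemma AE_has_real_derivative_primitive:
  fixes F h :: "real \<Rightarrow> real"
  assumes h: "integrable lborel h"
    and F: "\<And>t. t \<in> {a..b} \<Longrightarrow> F t = c + (LINT s|lborel. indicator {..t} s * h s)"
  shows "AE t in lborel. t \<in> {a..b} \<longrightarrow> (F has_real_derivative h t) (at t within {a..b})"
  using AE_has_real_derivative_indefinite_integral[OF h]
proof eventually_elim
  case (elim t)
  show ?case
  proof
    assume t: "t \<in> {a..b}"
    have "((\<lambda>t. c + (LINT s|lborel. indicator {..t} s * h s)) has_real_derivative h t) (at t within {a..b})"
      using DERIV_subset[OF elim, of "{a..b}"] by (auto intro!: derivative_eq_intros)
    then show "(F has_real_derivative h t) (at t within {a..b})"
      unfolding has_field_derivative_def by (rule has_derivative_transform[OF t F, rotated])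
  qed
qed

lemma absolutely_continuous_on_lipschitz_compose:
  assumes g: "absolutely_continuous_on a b g"
    and L: "\<And>x y. dist (f x) (f y) \<le> L * dist x y"
  shows "absolutely_continuous_on a b (\<lambda>t. f (g t))"
  unfolding absolutely_continuous_on_def
proof (intro allI impI)
  fix e :: real assume e: "e > 0"
  \<comment> \<open>\<open>L\<close> may be 0 or negative, while the division of \<open>e\<close>
    below needs a positive constant.\<close>
  define K where "K = max L 1"
  have K: "K > 0" "\<And>x y. dist (f x) (f y) \<le> K * dist x y"
    using order_trans[OF L mult_right_mono] by (auto simp: K_def)
  have "e / K > 0" using e K by simp
  then obtain d where d: "d > 0" "\<And>(n::nat) l r. (\<forall>i<n. a \<le> l i \<and> l i \<le> r i \<and> r i \<le> b) \<Longrightarrow>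
       disjoint_family_on (\<lambda>i. {l i<..<r i}) {..<n} \<Longrightarrow>
       (\<Sum>i<n. r i - l i) < d \<Longrightarrow> (\<Sum>i<n. dist (g (l i)) (g (r i))) < e / K"
    using g unfolding absolutely_continuous_on_def by blast
  show "\<exists>\<delta>>0. \<forall>(n::nat) l r. (\<forall>i<n. a \<le> l i \<and> l i \<le> r i \<and> r i \<le> b) \<longrightarrow>
       disjoint_family_on (\<lambda>i. {l i<..<r i}) {..<n} \<longrightarrow>
       (\<Sum>i<n. r i - l i) < \<delta> \<longrightarrow> (\<Sum>i<n. dist (f (g (l i))) (f (g (r i)))) < e"
  proof (intro exI[of _ d] conjI d(1) allI impI)
    fix n :: nat and l r :: "nat \<Rightarrow> real"
    assume lr: "\<forall>i<n. a \<le> l i \<and> l i \<le> r i \<and> r i \<le> b" "disjoint_family_on (\<lambda>i. {l i<..<r i}) {..<n}"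
       "(\<Sum>i<n. r i - l i) < d"
    have "(\<Sum>i<n. dist (f (g (l i))) (f (g (r i)))) \<le> K * (\<Sum>i<n. dist (g (l i)) (g (r i)))"
      unfolding sum_distrib_left by (intro sum_mono K)
    also have "\<dots> < K * (e / K)" using d(2)[OF lr] K by (intro mult_strict_left_mono)
    also have "\<dots> = e" using K by simp
    finally show "(\<Sum>i<n. dist (f (g (l i))) (f (g (r i)))) < e" .
  qed
qed

text \<open>Coordinates are 1-Lipschitz, so each coordinate of \<open>g\<close> is a primitive; the
  finitely many exceptional null sets are united.\<close>

lemma absolutely_continuous_on_AE_differentiable:
  fixes g :: "real \<Rightarrow> 'a::euclidean_space"
  assumes ab: "a < b" and g: "absolutely_continuous_on a b g"
  shows "AE t in lborel. t \<in> {a..b} \<longrightarrow> g differentiable (at t within {a..b})"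
proof -
  have "AE t in lborel. t \<in> {a..b} \<longrightarrow> (\<lambda>s. g s \<bullet> i) differentiable (at t within {a..b})" if "i \<in> Basis" for i
  proof -
    have "dist (x \<bullet> i) (y \<bullet> i) \<le> 1 * dist x y" for x y :: 'a
      using Basis_le_norm[OF that, of "x - y"] by (simp add: dist_norm inner_diff_left)
    then have "absolutely_continuous_on a b (\<lambda>s. g s \<bullet> i)"
      by (rule absolutely_continuous_on_lipschitz_compose[OF g])
    then obtain h where h: "integrable lborel h"
      "\<And>t. t \<in> {a..b} \<Longrightarrow> g t \<bullet> i = g a \<bullet> i + (LINT s|lborel. indicator {..t} s * h s)"
      using absolutely_continuous_on_imp_primitive[OF ab] by blast
    have "AE t in lborel. t \<in> {a..b} \<longrightarrow> ((\<lambda>s. g s \<bullet> i) has_real_derivative h t) (at t within {a..b})"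
      by (rule AE_has_real_derivative_primitive[OF h])
    then show ?thesis
      by eventually_elim (auto simp: real_differentiable_def)
  qed
  then have "AE t in lborel. \<forall>i\<in>Basis. t \<in> {a..b} \<longrightarrow> (\<lambda>s. g s \<bullet> i) differentiable (at t within {a..b})"
    by (subst AE_ball_countable) (auto intro: countable_finite)
  then show ?thesis
    by eventually_elim (subst differentiable_componentwise_within, auto)
qed

subsection \<open>The space of curves\<close>

lemma openin_curve_subset:
  "{U. openin (mtopology_of (curve_metric T)) U} \<subseteq> Pow (mspace (curve_metric T))"
  using openin_subset[of "mtopology_of (curve_metric T)"] by (metis Pow_iff mem_Collect_eq subsetI topspace_mtopology_of)

lemma space_curve_borel: "space (curve_borel T) = mspace (curve_metric T)"
  unfolding curve_borel_def using openin_curve_subset by (rule space_measure_of)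

lemma curve_continuous_on:
  assumes "\<gamma> \<in> space (curve_borel T)"
  shows "continuous_on {0..T} \<gamma>"
  using assms by (simp add: space_curve_borel curve_metric_def)

text \<open>Evaluation is 1-Lipschitz for the sup metric, hence continuous, and the open sets
  generate \<open>curve_borel T\<close>.\<close>

lemma eval_at_measurable [measurable]:
  fixes t T :: real
  assumes t: "t \<in> {0..T}"
  shows "(eval_at t :: (real \<Rightarrow> 'a::euclidean_space) \<Rightarrow> 'a) \<in> curve_borel T \<rightarrow>\<^sub>M borel"
proof (rule borel_measurableI)
  let ?m = "curve_metric T :: (real \<Rightarrow> 'a) metric"
  have "Lipschitz_continuous_map ?m euclidean_metric (eval_at t)"
    unfolding Lipschitz_continuous_map_def
  proof (intro conjI exI[of _ 1] ballI)
    fix f g assume "f \<in> mspace ?m" "g \<in> mspace ?m"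
    then show "mdist euclidean_metric (eval_at t f) (eval_at t g) \<le> 1 * mdist ?m f g"
      using mdist_cfunspace_imp_mdist_le[of f "top_of_set {0..T}" euclidean_metric g "mdist ?m f g" t] t
      by (simp add: curve_metric_def eval_at_def)
  qed simp
  then have c: "continuous_map (mtopology_of ?m) euclidean (eval_at t)"
    using Lipschitz_continuous_imp_continuous_map by fastforce
  fix S :: "'a set" assume "open S"
  then have "openin (mtopology_of ?m) {x \<in> mspace ?m. eval_at t x \<in> S}"
    using openin_continuous_map_preimage[OF c, of S] by (simp add: open_openin[symmetric])
  moreover have "eval_at t -` S \<inter> space (curve_borel T) = {x \<in> mspace ?m. eval_at t x \<in> S}"
    by (auto simp: space_curve_borel)
  ultimately show "eval_at t -` S \<inter> space (curve_borel T) \<in> sets (curve_borel T)"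
    using sigma_sets.Basic[of _ "{U. openin (mtopology_of ?m) U}"]
    by (simp add: curve_borel_def sets_measure_of[OF openin_curve_subset])
qed

section \<open>Joint measurability in time and curve\<close>

text \<open>The retraction of the line onto \<open>[0, T]\<close> when \<open>0 \<le> T\<close>.
  Elements of the curve space are \<open>undefined\<close> outside \<open>[0, T]\<close>; composed
  with \<open>clip T\<close> they become continuous on the whole line.\<close>

definition clip :: "real \<Rightarrow> real \<Rightarrow> real"
  where "clip T t = max 0 (min T t)"

lemma clip_in: "0 \<le> T \<Longrightarrow> clip T t \<in> {0..T}"
  by (auto simp: clip_def)

lemma clip_eq: "t \<in> {0..T} \<Longrightarrow> clip T t = t"
  by (auto simp: clip_def)

lemma continuous_on_clip: "continuous_on UNIV (clip T)"
  unfolding clip_def by (intro continuous_intros)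

lemma curve_clip_continuous:
  assumes "0 \<le> T" "\<gamma> \<in> space (curve_borel T)"
  shows "continuous_on UNIV (\<lambda>t. \<gamma> (clip T t))"
  using clip_in[OF assms(1)]
  by (intro continuous_on_compose2[OF curve_continuous_on[OF assms(2)] continuous_on_clip]) auto

text \<open>A function measurable in the curve and continuous in time is jointly measurable:
  rounding the time down to multiples of \<open>1 / Suc n\<close> leaves countably many evaluations,
  and the rounded functions converge by continuity.\<close>

lemma measurable_eval_clip [measurable]:
  fixes T :: real
  assumes T: "0 \<le> T"
  shows "(\<lambda>(t, \<gamma>). \<gamma> (clip T t) :: 'a::euclidean_space) \<in> borel_measurable (borel \<Otimes>\<^sub>M curve_borel T)"
proof (rule borel_measurable_LIMSEQ_metric[where
      f="\<lambda>n (t, \<gamma>). \<gamma> (clip T (real_of_int \<lfloor>real (Suc n) * t\<rfloor> / real (Suc n)))"])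
  fix n
  define f where "f i x = eval_at (clip T (real_of_int i / real (Suc n))) (snd x)"
    for i :: int and x :: "real \<times> (real \<Rightarrow> 'a)"
  have "(\<lambda>x. f \<lfloor>real (Suc n) * fst x\<rfloor> x) \<in> borel_measurable (borel \<Otimes>\<^sub>M curve_borel T)"
  proof (rule measurable_compose_countable[where f=f])
    show "f i \<in> borel_measurable (borel \<Otimes>\<^sub>M curve_borel T)" for i
      unfolding f_def using clip_in[OF T] by (intro measurable_compose[OF measurable_snd] eval_at_measurable)
  qed measurable
  then show "(\<lambda>(t, \<gamma>). \<gamma> (clip T (real_of_int \<lfloor>real (Suc n) * t\<rfloor> / real (Suc n))) :: 'a) \<in> borel_measurable (borel \<Otimes>\<^sub>M curve_borel T)"
    by (simp add: f_def eval_at_def case_prod_beta)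
next
  fix x :: "real \<times> (real \<Rightarrow> 'a)" assume x: "x \<in> space (borel \<Otimes>\<^sub>M curve_borel T)"
  obtain t \<gamma> where [simp]: "x = (t, \<gamma>)" by (cases x)
  have \<gamma>: "\<gamma> \<in> space (curve_borel T)" using x by (auto simp: space_pair_measure)
  have "(\<lambda>n. real_of_int \<lfloor>real (Suc n) * t\<rfloor> / real (Suc n)) \<longlonglongrightarrow> t"
  proof (rule tendsto_sandwich)
    show "\<forall>\<^sub>F n in sequentially. t - 1 / real (Suc n) \<le> real_of_int \<lfloor>real (Suc n) * t\<rfloor> / real (Suc n)"
    proof (intro always_eventually allI)
      fix n
      have "real (Suc n) * t - 1 \<le> real_of_int \<lfloor>real (Suc n) * t\<rfloor>" by linarith
      then have "(real (Suc n) * t - 1) / real (Suc n) \<le> real_of_int \<lfloor>real (Suc n) * t\<rfloor> / real (Suc n)"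
        by (intro divide_right_mono) auto
      then show "t - 1 / real (Suc n) \<le> real_of_int \<lfloor>real (Suc n) * t\<rfloor> / real (Suc n)"
        by (simp add: diff_divide_distrib)
    qed
    show "\<forall>\<^sub>F n in sequentially. real_of_int \<lfloor>real (Suc n) * t\<rfloor> / real (Suc n) \<le> t"
    proof (intro always_eventually allI)
      fix n
      have "real_of_int \<lfloor>real (Suc n) * t\<rfloor> / real (Suc n) \<le> (real (Suc n) * t) / real (Suc n)"
        by (intro divide_right_mono of_int_floor_le) auto
      then show "real_of_int \<lfloor>real (Suc n) * t\<rfloor> / real (Suc n) \<le> t" by simp
    qed
    show "(\<lambda>n. t - 1 / real (Suc n)) \<longlonglongrightarrow> t"
      using tendsto_diff[OF tendsto_const[of t] LIMSEQ_inverse_real_of_nat] by (simp add: inverse_eq_divide)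
  qed simp
  then show "(\<lambda>n. (case x of (t, \<gamma>) \<Rightarrow> \<gamma> (clip T (real_of_int \<lfloor>real (Suc n) * t\<rfloor> / real (Suc n))))) \<longlonglongrightarrow> (case x of (t, \<gamma>) \<Rightarrow> \<gamma> (clip T t))"
    using continuous_on_tendsto_compose[OF curve_clip_continuous[OF T \<gamma>], of _ t sequentially] by simp
qed

definition difference_quotient :: "(real \<Rightarrow> 'a::real_normed_vector) \<Rightarrow> real \<Rightarrow> real \<Rightarrow> 'a"
  where "difference_quotient u t h = (u (t + h) - u t) /\<^sub>R h"

text \<open>The Cauchy criterion for existence of the derivative at \<open>t\<close>, with
  quantifiers over naturals and rationals only, so that it cuts out a measurable set.\<close>

definition rational_quotients_Cauchy :: "(real \<Rightarrow> 'a::real_normed_vector) \<Rightarrow> real \<Rightarrow> bool"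
  where "rational_quotients_Cauchy u t \<longleftrightarrow> (\<forall>k::nat. \<exists>m::nat. \<forall>p q :: rat.
    p \<noteq> 0 \<and> \<bar>real_of_rat p\<bar> < 1 / Suc m \<and> q \<noteq> 0 \<and> \<bar>real_of_rat q\<bar> < 1 / Suc m \<longrightarrow>
    dist (difference_quotient u t (real_of_rat p)) (difference_quotient u t (real_of_rat q)) < 1 / Suc k)"

lemma has_vector_derivative_iff_difference_quotient:
  "(u has_vector_derivative d) (at t) \<longleftrightarrow> (difference_quotient u t \<longlongrightarrow> d) (at 0)"
proof -
  have "(u has_vector_derivative d) (at t) \<longleftrightarrow> (\<lambda>h. norm (u (t + h) - u t - h *\<^sub>R d) / norm h) \<midarrow>0\<rightarrow> 0"
    by (simp add: has_vector_derivative_def has_derivative_at bounded_linear_scaleR_left)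
  also have "\<dots> \<longleftrightarrow> (\<lambda>h. norm (difference_quotient u t h - d)) \<midarrow>0\<rightarrow> 0"
  proof (rule Lim_cong_within[OF refl refl refl])
    fix h :: real assume "h \<noteq> 0"
    then have "difference_quotient u t h - d = (u (t + h) - u t - h *\<^sub>R d) /\<^sub>R h"
      by (simp add: difference_quotient_def scaleR_diff_right)
    then show "norm (u (t + h) - u t - h *\<^sub>R d) / norm h = norm (difference_quotient u t h - d)"
      by (simp add: divide_inverse_commute)
  qed
  also have "\<dots> \<longleftrightarrow> (difference_quotient u t \<longlongrightarrow> d) (at 0)"
    by (simp add: tendsto_norm_zero_iff LIM_zero_iff)
  finally show ?thesis .
qed

lemma differentiable_imp_rational_quotients_Cauchy:
  assumes "u differentiable (at t)"
  shows "rational_quotients_Cauchy u t"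
  unfolding rational_quotients_Cauchy_def
proof
  fix k
  obtain d where d: "(difference_quotient u t \<longlongrightarrow> d) (at 0)"
    using assms by (auto simp: vector_derivative_works has_vector_derivative_iff_difference_quotient)
  have "0 < 1 / real (Suc k) / 2" by simp
  from tendstoD[OF d this] obtain e where e: "e > 0"
    "\<And>h. h \<noteq> 0 \<Longrightarrow> \<bar>h\<bar> < e \<Longrightarrow> dist (difference_quotient u t h) d < 1 / real (Suc k) / 2"
    by (auto simp: eventually_at)
  obtain m where m: "1 / real (Suc m) < e" using nat_approx_posE[OF e(1)] by blast
  show "\<exists>m. \<forall>p q :: rat. p \<noteq> 0 \<and> \<bar>real_of_rat p\<bar> < 1 / Suc m \<and> q \<noteq> 0 \<and> \<bar>real_of_rat q\<bar> < 1 / Suc m \<longrightarrow>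
    dist (difference_quotient u t (real_of_rat p)) (difference_quotient u t (real_of_rat q)) < 1 / Suc k"
  proof (intro exI[of _ m] allI impI)
    fix p q :: rat assume "p \<noteq> 0 \<and> \<bar>real_of_rat p\<bar> < 1 / Suc m \<and> q \<noteq> 0 \<and> \<bar>real_of_rat q\<bar> < 1 / Suc m"
    then show "dist (difference_quotient u t (real_of_rat p)) (difference_quotient u t (real_of_rat q)) < 1 / Suc k"
      using m by (intro dist_triangle_half_l[OF e(2) e(2)]) auto
  qed
qed

text \<open>At a nonzero increment the difference quotient is continuous in the increment, so the
  rational Cauchy condition passes to real increments; completeness supplies the limit along
  \<open>1 / Suc n\<close>.\<close>

lemma rational_quotients_Cauchy_imp_differentiable:
  fixes u :: "real \<Rightarrow> 'a::banach"
  assumes u: "continuous_on UNIV u" and c: "rational_quotients_Cauchy u t"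
  shows "u differentiable (at t)"
proof -
  let ?D = "difference_quotient u t"
  \<comment> \<open>One increment becomes real and the other stays rational, which is the form
    needed to compare with the rational sequence \<open>x\<close> below.\<close>
  have near: "\<exists>m. \<forall>h q. h \<noteq> 0 \<and> \<bar>h\<bar> < 1 / Suc m \<and> q \<in> \<rat> \<and> q \<noteq> 0 \<and> \<bar>q\<bar> < 1 / Suc m \<longrightarrow> dist (?D h) (?D q) < e"
    if e: "e > 0" for e
  proof -
    obtain k where k: "1 / real (Suc k) < e / 2" using nat_approx_posE[of "e / 2"] e by auto
    obtain m where m: "\<And>p q. p \<in> \<rat> \<Longrightarrow> q \<in> \<rat> \<Longrightarrow> 0 < \<bar>p\<bar> \<and> \<bar>p\<bar> < 1 / Suc m \<and> 0 < \<bar>q\<bar> \<and> \<bar>q\<bar> < 1 / Suc m \<Longrightarrow>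
      dist (?D p) (?D q) < 1 / Suc k"
    proof -
      obtain m where "\<forall>p q :: rat. p \<noteq> 0 \<and> \<bar>real_of_rat p\<bar> < 1 / Suc m \<and> q \<noteq> 0 \<and> \<bar>real_of_rat q\<bar> < 1 / Suc m \<longrightarrow>
        dist (?D (real_of_rat p)) (?D (real_of_rat q)) < 1 / Suc k"
        using c unfolding rational_quotients_Cauchy_def by blast
      then show thesis by (intro that[of m]) (auto elim!: Rats_cases)
    qed
    have "dist (?D h) (?D q) < e" if hq: "h \<noteq> 0" "\<bar>h\<bar> < 1 / Suc m" "q \<in> \<rat>" "q \<noteq> 0" "\<bar>q\<bar> < 1 / Suc m" for h q
    proof -
      have "continuous_on UNIV (\<lambda>h. u (t + h))"
        by (intro continuous_on_compose2[OF u] continuous_intros) auto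
      then have "isCont (\<lambda>h. u (t + h)) h" by (simp add: continuous_on_eq_continuous_at)
      then have "isCont (\<lambda>h. (u (t + h) - u t) /\<^sub>R h) h"
        using hq(1) by (intro continuous_intros)
      then have "isCont ?D h" by (simp add: difference_quotient_def[abs_def])
      then have "(?D \<longlongrightarrow> ?D h) (nhds h)" by (simp add: isCont_def tendsto_at_iff_tendsto_nhds)
      from tendstoD[OF this, of "e / 2"] have "\<forall>\<^sub>F p in nhds h. dist (?D p) (?D h) < e / 2"
        using e by simp
      moreover have "\<forall>\<^sub>F p in nhds h. p \<in> {p. 0 < \<bar>p\<bar> \<and> \<bar>p\<bar> < 1 / Suc m}"
        using hq by (intro eventually_nhds_in_open open_Collect_conj open_Collect_less continuous_intros) auto
      ultimately have "\<forall>\<^sub>F p in nhds h. dist (?D p) (?D h) < e / 2 \<and> 0 < \<bar>p\<bar> \<and> \<bar>p\<bar> < 1 / Suc m"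
        by eventually_elim auto
      then obtain r where r: "r > 0" "\<And>p. dist p h < r \<Longrightarrow> dist (?D p) (?D h) < e / 2 \<and> 0 < \<bar>p\<bar> \<and> \<bar>p\<bar> < 1 / Suc m"
        unfolding eventually_nhds_metric by blast
      obtain p where p: "p \<in> \<rat>" "h < p" "p < h + r" using Rats_dense_in_real[of h "h + r"] r(1) by auto
      then have p': "dist (?D p) (?D h) < e / 2 \<and> 0 < \<bar>p\<bar> \<and> \<bar>p\<bar> < 1 / Suc m"
        by (intro r(2)) (auto simp: dist_real_def)
      then have "dist (?D p) (?D q) < 1 / Suc k" using hq p(1) by (intro m) auto
      then show ?thesis using k p' dist_triangle3[of "?D h" "?D q" "?D p"] by linarith
    qed
    then show ?thesis by blast
  qed
  define x where "x n = ?D (1 / Suc n)" for n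
  have rat: "1 / real (Suc n) \<in> \<rat>" "1 / real (Suc n) \<noteq> 0" for n by auto
  have sm: "\<bar>1 / real (Suc n)\<bar> < 1 / real (Suc m)" if "n > m" for n m using that by (simp add: frac_less2)
  have "Cauchy x"
    unfolding Cauchy_def
  proof (intro allI impI)
    fix e :: real assume "e > 0"
    then obtain m where m: "\<forall>h q. h \<noteq> 0 \<and> \<bar>h\<bar> < 1 / Suc m \<and> q \<in> \<rat> \<and> q \<noteq> 0 \<and> \<bar>q\<bar> < 1 / Suc m \<longrightarrow> dist (?D h) (?D q) < e"
      using near by blast
    show "\<exists>M. \<forall>m\<ge>M. \<forall>n\<ge>M. dist (x m) (x n) < e"
    \<comment> \<open>\<open>x i\<close> has increment \<open>1 / Suc i\<close>, which is strictly
      below \<open>1 / Suc m\<close> only for \<open>i > m\<close>.\<close>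
    proof (intro exI[of _ "Suc m"] allI impI)
      fix i j assume "Suc m \<le> i" "Suc m \<le> j"
      then show "dist (x i) (x j) < e" unfolding x_def using m rat sm by auto
    qed
  qed
  then obtain L where L: "x \<longlonglongrightarrow> L" by (auto simp: Cauchy_convergent_iff convergent_def)
  have "(?D \<longlongrightarrow> L) (at 0)"
  proof (rule tendstoI)
    fix e :: real assume e: "e > 0"
    then obtain m where m: "\<forall>h q. h \<noteq> 0 \<and> \<bar>h\<bar> < 1 / Suc m \<and> q \<in> \<rat> \<and> q \<noteq> 0 \<and> \<bar>q\<bar> < 1 / Suc m \<longrightarrow> dist (?D h) (?D q) < e / 2"
      using near[of "e / 2"] by auto
    have "\<forall>\<^sub>F n in sequentially. dist (x n) L < e / 2" using L e by (intro tendstoD) auto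
    then obtain n where n: "dist (x n) L < e / 2" "n > m"
      using eventually_happens'[OF sequentially_bot eventually_conj[OF _ eventually_gt_at_top[of m]]] by blast
    show "\<forall>\<^sub>F h in at 0. dist (?D h) L < e"
      unfolding eventually_at
    proof (intro exI[of _ "1 / Suc m"] conjI ballI impI)
      fix h :: real assume h: "h \<noteq> 0 \<and> dist h 0 < 1 / Suc m"
      then have "dist (?D h) (x n) < e / 2" unfolding x_def using m rat[of n] sm[OF n(2)] by auto
      then show "dist (?D h) L < e" using n(1) dist_triangle[of "?D h" L "x n"] by simp
    qed simp
  qed
  then have "(u has_vector_derivative L) (at t)" by (simp add: has_vector_derivative_iff_difference_quotient)
  then show ?thesis by (rule differentiableI_vector)
qed

lemma measurable_differentiable_clip:
  fixes T :: real
  assumes T: "0 \<le> T"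
  shows "Measurable.pred (borel \<Otimes>\<^sub>M curve_borel T)
    (\<lambda>(t, \<gamma> :: real \<Rightarrow> 'a::euclidean_space). (\<lambda>s. \<gamma> (clip T s)) differentiable (at t))"
proof -
  have E [measurable]: "(\<lambda>x :: real \<times> (real \<Rightarrow> 'a). snd x (clip T (fst x + h))) \<in> borel_measurable (borel \<Otimes>\<^sub>M curve_borel T)" for h
  proof -
    have "(\<lambda>x :: real \<times> (real \<Rightarrow> 'a). (fst x + h, snd x)) \<in> borel \<Otimes>\<^sub>M curve_borel T \<rightarrow>\<^sub>M borel \<Otimes>\<^sub>M curve_borel T"
      by measurable
    from measurable_compose[OF this measurable_eval_clip[OF T]] show ?thesis by simp
  qed
  have [measurable]: "(\<lambda>x :: real \<times> (real \<Rightarrow> 'a). difference_quotient (\<lambda>s. snd x (clip T s)) (fst x) h) \<in> borel_measurable (borel \<Otimes>\<^sub>M curve_borel T)" for h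
    using E[of 0] E[of h] unfolding difference_quotient_def by simp
  have "Measurable.pred (borel \<Otimes>\<^sub>M curve_borel T)
    (\<lambda>x :: real \<times> (real \<Rightarrow> 'a). rational_quotients_Cauchy (\<lambda>s. snd x (clip T s)) (fst x))"
    unfolding rational_quotients_Cauchy_def by measurable
  then show ?thesis
    by (subst measurable_cong[where g="\<lambda>x. rational_quotients_Cauchy (\<lambda>s. snd x (clip T s)) (fst x)"])
       (auto simp: space_pair_measure intro: differentiable_imp_rational_quotients_Cauchy
          intro!: rational_quotients_Cauchy_imp_differentiable curve_clip_continuous T)
qed

lemma eventually_nhds_clip_eq:
  assumes "0 < t" "t < T"
  shows "\<forall>\<^sub>F s in nhds t. \<gamma> (clip T s) = \<gamma> s"
proof -
  have "\<forall>\<^sub>F s in nhds t. s \<in> {0<..<T}" using assms by (intro eventually_nhds_in_open) auto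
  then show ?thesis by eventually_elim (simp add: clip_eq)
qed

lemma has_vector_derivative_clip_iff:
  assumes "0 < t" "t < T"
  shows "((\<lambda>s. \<gamma> (clip T s)) has_vector_derivative d) (at t) \<longleftrightarrow> (\<gamma> has_vector_derivative d) (at t within {0..T})"
proof -
  have "((\<lambda>s. \<gamma> (clip T s)) has_vector_derivative d) (at t) \<longleftrightarrow> (\<gamma> has_vector_derivative d) (at t)"
    using assms clip_eq[of t T]
    by (intro has_vector_derivative_cong_ev) (auto intro: eventually_mono[OF eventually_nhds_clip_eq[OF assms]])
  then show ?thesis using assms by (simp add: at_within_Icc_at)
qed

lemma differentiable_clip_iff:
  assumes "0 < t" "t < T"
  shows "(\<lambda>s. \<gamma> (clip T s)) differentiable (at t) \<longleftrightarrow> \<gamma> differentiable (at t within {0..T})"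
  using has_vector_derivative_clip_iff[OF assms, of \<gamma>]
  by (meson differentiableI_vector vector_derivative_works)

text \<open>On the measurable set of differentiability the velocity is the limit of the quotients
  with increments \<open>1 / Suc n\<close>; off it, \<open>vector_derivative\<close> is one fixed
  constant. The end points are set to 0, because there the derivative of the clipped curve and the
  one-sided derivative need not agree.\<close>

lemma measurable_velocity:
  fixes T :: real
  assumes T: "0 \<le> T"
  shows "(\<lambda>(t, \<gamma> :: real \<Rightarrow> 'a::euclidean_space). if t \<in> {0<..<T} then velocity T \<gamma> t else 0)
    \<in> borel_measurable (borel \<Otimes>\<^sub>M curve_borel T)"
proof -
  \<comment> \<open>The junk value of \<open>velocity\<close> where the derivative does not exist.\<close>
  define c :: 'a where "c = (SOME d. False)"
  define D where "D n x = difference_quotient (\<lambda>s. snd x (clip T s)) (fst x) (1 / Suc n)" for n and x :: "real \<times> (real \<Rightarrow> 'a)"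
  have E [measurable]: "(\<lambda>x :: real \<times> (real \<Rightarrow> 'a). snd x (clip T (fst x + h))) \<in> borel_measurable (borel \<Otimes>\<^sub>M curve_borel T)" for h
  proof -
    have "(\<lambda>x :: real \<times> (real \<Rightarrow> 'a). (fst x + h, snd x)) \<in> borel \<Otimes>\<^sub>M curve_borel T \<rightarrow>\<^sub>M borel \<Otimes>\<^sub>M curve_borel T"
      by measurable
    from measurable_compose[OF this measurable_eval_clip[OF T]] show ?thesis by simp
  qed
  have [measurable]: "D n \<in> borel_measurable (borel \<Otimes>\<^sub>M curve_borel T)" for n
    using E[of 0] E[of "1 / Suc n"] unfolding D_def difference_quotient_def by simp
  note [measurable] = measurable_differentiable_clip[OF T, where 'a='a]
  have "(\<lambda>x. if fst x \<in> {0<..<T} then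
      if (case x of (t, \<gamma>) \<Rightarrow> (\<lambda>s. \<gamma> (clip T s)) differentiable (at t)) then lim (\<lambda>n. D n x) else c else 0)
    \<in> borel_measurable (borel \<Otimes>\<^sub>M curve_borel T)"
    by measurable
  also have "(\<lambda>x. if fst x \<in> {0<..<T} then
      if (case x of (t, \<gamma>) \<Rightarrow> (\<lambda>s. \<gamma> (clip T s)) differentiable (at t)) then lim (\<lambda>n. D n x) else c else 0)
    = (\<lambda>(t, \<gamma>). if t \<in> {0<..<T} then velocity T \<gamma> t else 0)"
  proof (intro ext, clarify)
    fix t and \<gamma> :: "real \<Rightarrow> 'a"
    have "(if (\<lambda>s. \<gamma> (clip T s)) differentiable (at t) then lim (\<lambda>n. D n (t, \<gamma>)) else c) = velocity T \<gamma> t"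
      if t: "0 < t" "t < T"
    proof (cases "(\<lambda>s. \<gamma> (clip T s)) differentiable (at t)")
      case True
      then obtain d where d: "((\<lambda>s. \<gamma> (clip T s)) has_vector_derivative d) (at t)"
        using vector_derivative_works by blast
      then have "(\<gamma> has_vector_derivative d) (at t within {0..T})"
        by (simp add: has_vector_derivative_clip_iff[OF t])
      then have "velocity T \<gamma> t = d"
        unfolding velocity_def using t vector_derivative_within_closed_interval[of 0 T t \<gamma> d] by simp
      moreover have "(\<lambda>n. D n (t, \<gamma>)) \<longlonglongrightarrow> d"
      proof -
        have "filterlim (\<lambda>n. 1 / real (Suc n)) (at 0) sequentially"
          unfolding filterlim_at using LIMSEQ_inverse_real_of_nat by (simp add: inverse_eq_divide)
        from filterlim_compose[OF d[unfolded has_vector_derivative_iff_difference_quotient] this]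
        show ?thesis by (simp add: D_def)
      qed
      ultimately show ?thesis using True by (simp add: limI)
    next
      case False
      then have "\<not> (\<gamma> has_vector_derivative d) (at t within {0..T})" for d
        using differentiable_clip_iff[OF t, of \<gamma>] differentiableI_vector by blast
      then show ?thesis using False by (simp add: velocity_def vector_derivative_def c_def)
    qed
    then show "(if fst (t, \<gamma>) \<in> {0<..<T} then
      if (\<lambda>s. \<gamma> (clip T s)) differentiable (at t) then lim (\<lambda>n. D n (t, \<gamma>)) else c else 0)
      = (if t \<in> {0<..<T} then velocity T \<gamma> t else 0)" by simp
  qed
  finally show ?thesis .
qed

subsection \<open>Test functions\<close>

lemma test_function_C_k: "f \<in> test_functions \<Longrightarrow> C_k k f"
  by (simp add: test_functions_def)

lemma test_function_has_derivative:
  assumes "f \<in> test_functions"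
  shows "(f has_derivative (\<lambda>v. grad f x \<bullet> v)) (at x)"
proof -
  have d: "f differentiable (at x)" using test_function_C_k[OF assms, of "Suc 0"] by simp
  have "grad f x \<bullet> v = frechet_derivative f (at x) v" for v
  proof -
    have "frechet_derivative f (at x) v = frechet_derivative f (at x) (\<Sum>b\<in>Basis. (v \<bullet> b) *\<^sub>R b)"
      by (simp add: euclidean_representation)
    also have "\<dots> = (\<Sum>b\<in>Basis. (v \<bullet> b) * frechet_derivative f (at x) b)"
      using linear_frechet_derivative[OF d] by (simp add: linear_sum linear_cmul)
    also have "\<dots> = grad f x \<bullet> v"
      unfolding grad_def inner_sum_left by (simp add: inner_commute mult.commute)
    finally show ?thesis ..
  qed
  then show ?thesis using frechet_derivative_works[THEN iffD1, OF d] by simp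
qed

lemma test_function_continuous_on:
  assumes "f \<in> test_functions"
  shows "continuous_on A f"
  using test_function_has_derivative[OF assms]
  by (meson continuous_at_imp_continuous_on has_derivative_continuous)

lemma continuous_on_grad_test_function:
  assumes "f \<in> test_functions"
  shows "continuous_on A (grad f)"
proof -
  have "continuous_on UNIV (\<lambda>x. frechet_derivative f (at x) b)" if "b \<in> Basis" for b
    using test_function_C_k[OF assms, of "Suc 0"] that by simp
  then have "continuous_on UNIV (grad f)"
    unfolding grad_def by (intro continuous_intros)
  then show ?thesis by (rule continuous_on_subset) simp
qed

lemma continuous_compact_support_bounded:
  fixes g :: "'a::euclidean_space \<Rightarrow> 'b::real_normed_vector"
  assumes "continuous_on UNIV g" "compact K" "\<And>x. x \<notin> K \<Longrightarrow> g x = 0"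
  obtains C where "C \<ge> 0" "\<And>x. norm (g x) \<le> C"
proof -
  have "bounded (g ` K)"
    using assms by (intro compact_imp_bounded compact_continuous_image continuous_on_subset[OF assms(1)]) auto
  then obtain C where "\<And>x. x \<in> K \<Longrightarrow> norm (g x) \<le> C" by (auto simp: bounded_iff)
  then have "norm (g x) \<le> max C 0" for x
    using assms(3)[of x] by (cases "x \<in> K") (auto simp: le_max_iff_disj)
  then show thesis by (intro that[of "max C 0"]) auto
qed

lemma test_function_bounded:
  assumes f: "f \<in> test_functions"
  obtains C where "C \<ge> 0" "\<And>x. \<bar>f x\<bar> \<le> C"
proof -
  have "compact (closure {x. f x \<noteq> 0})" using f by (simp add: test_functions_def)
  moreover have "f x = 0" if "x \<notin> closure {x. f x \<noteq> 0}" for x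
    using that closure_subset[of "{x. f x \<noteq> 0}"] by blast
  ultimately show thesis
    using continuous_compact_support_bounded[OF test_function_continuous_on[OF f]] that by (metis real_norm_def)
qed

text \<open>Off the closed support \<open>f\<close> vanishes near the point, so uniqueness of the
  derivative makes the gradient 0; a continuous function vanishing off a compact set is
  bounded.\<close>

lemma grad_test_function_bounded:
  assumes f: "f \<in> test_functions"
  obtains C where "C \<ge> 0" "\<And>x. norm (grad f x) \<le> C"
proof -
  let ?K = "closure {x. f x \<noteq> 0}"
  have "grad f x = 0" if x: "x \<notin> ?K" for x
  proof -
    have "\<forall>\<^sub>F y in nhds x. y \<in> - ?K" using x by (intro eventually_nhds_in_open) auto
    then have ev: "\<forall>\<^sub>F y in nhds x. f y = 0"
      by eventually_elim (use closure_subset[of "{x. f x \<noteq> 0}"] in blast)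
    then have "f x = 0" by (rule eventually_nhds_x_imp_x)
    have "((\<lambda>_. 0) has_derivative (\<lambda>v. grad f x \<bullet> v)) (at x)"
      using test_function_has_derivative[OF f, of x]
      by (rule has_derivative_transform_eventually)
         (use ev \<open>f x = 0\<close> in \<open>auto simp: eventually_nhds_conv_at\<close>)
    then have "(\<lambda>v. grad f x \<bullet> v) = (\<lambda>v. 0)"
      by (rule has_derivative_unique) simp
    then have "grad f x \<bullet> grad f x = 0" by (rule fun_cong)
    then show ?thesis by simp
  qed
  moreover have "compact ?K" using f by (simp add: test_functions_def)
  ultimately show thesis
    using continuous_compact_support_bounded[OF continuous_on_grad_test_function[OF f]] that by metis
qed

text \<open>The gradient bound is an operator norm bound for the derivative, so the mean value
  inequality applies. Lipschitz continuity is what carries absolute continuity from a curve to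
  \<open>f\<close> along it.\<close>

lemma test_function_lipschitz:
  assumes f: "f \<in> test_functions"
  obtains C where "\<And>x y. dist (f x) (f y) \<le> C * dist x y"
proof -
  obtain C where C: "C \<ge> 0" "\<And>x. norm (grad f x) \<le> C" using grad_test_function_bounded[OF f] by blast
  have "onorm (\<lambda>v. grad f x \<bullet> v) \<le> C" for x
  proof (rule onorm_le)
    fix v
    show "norm (grad f x \<bullet> v) \<le> C * norm v"
      using Cauchy_Schwarz_ineq2[of "grad f x" v] mult_right_mono[OF C(2)[of x] norm_ge_zero[of v]] by simp
  qed
  then have "norm (f x - f y) \<le> C * norm (x - y)" for x y
    using test_function_has_derivative[OF f]
    by (intro differentiable_bound[OF convex_UNIV, where f'="\<lambda>x v. grad f x \<bullet> v"]) auto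
  then show thesis by (intro that[of C]) (auto simp: dist_norm)
qed

subsection \<open>Disintegration\<close>

text \<open>Both notions of disintegration are stated for nonnegative functions; splitting
  \<open>g\<close> into positive and negative parts extends them to integrable ones. The map
  \<open>\<phi>\<close> serves both: \<open>\<lambda>y z. z\<close> for
  \<open>disintegration_along\<close>, \<open>Pair\<close> for
  \<open>disintegration_fst\<close>.\<close>

lemma
  fixes g :: "'z \<Rightarrow> real" and \<phi> :: "'y \<Rightarrow> 'v \<Rightarrow> 'z"
  assumes nn: "\<And>u :: 'z \<Rightarrow> ennreal. u \<in> borel_measurable M \<Longrightarrow>
      (\<integral>\<^sup>+z. u z \<partial>M) = (\<integral>\<^sup>+y. (\<integral>\<^sup>+v. u (\<phi> y v) \<partial>\<kappa> y) \<partial>N)"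
    and meas: "\<And>u :: 'z \<Rightarrow> ennreal. u \<in> borel_measurable M \<Longrightarrow> (\<lambda>y. \<integral>\<^sup>+v. u (\<phi> y v) \<partial>\<kappa> y) \<in> borel_measurable N"
    and \<phi>: "\<And>y. y \<in> space N \<Longrightarrow> \<phi> y \<in> \<kappa> y \<rightarrow>\<^sub>M M"
    and g: "integrable M g"
  shows AE_integrable_disintegration: "AE y in N. integrable (\<kappa> y) (\<lambda>v. g (\<phi> y v))"
    and borel_measurable_integral_disintegration: "(\<lambda>y. \<integral>v. g (\<phi> y v) \<partial>\<kappa> y) \<in> borel_measurable N"
    and integral_disintegration: "(\<integral>z. g z \<partial>M) = (\<integral>y. (\<integral>v. g (\<phi> y v) \<partial>\<kappa> y) \<partial>N)"
proof -
  have [measurable]: "g \<in> borel_measurable M" using g by simp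
  \<comment> \<open>\<open>ennreal\<close> sends negative reals to 0, so \<open>P 1\<close> and
    \<open>P (-1)\<close> integrate the positive and the negative part.\<close>
  define P where "P s y = (\<integral>\<^sup>+v. ennreal (s * g (\<phi> y v)) \<partial>\<kappa> y)" for s y
  have [measurable]: "P s \<in> borel_measurable N" for s unfolding P_def by (rule meas) simp
  have total: "(\<integral>\<^sup>+z. ennreal (s * g z) \<partial>M) = (\<integral>\<^sup>+y. P s y \<partial>N)" for s
    unfolding P_def by (rule nn) simp
  have "(\<integral>\<^sup>+y. P 1 y \<partial>N) \<noteq> \<infinity>" "(\<integral>\<^sup>+y. P (-1) y \<partial>N) \<noteq> \<infinity>"
    using g unfolding total[symmetric] real_integrable_def by auto
  then have fin: "(\<integral>\<^sup>+y. P s y \<partial>N) \<noteq> \<infinity>" if "s \<in> {1, -1}" for s using that by auto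
  have AEP: "AE y in N. P s y \<noteq> \<infinity>" if "s \<in> {1, -1}" for s
    using fin[OF that] by (intro nn_integral_noteq_infinite) auto
  have int: "integrable (\<kappa> y) (\<lambda>v. g (\<phi> y v))"
    and eq: "(\<integral>v. g (\<phi> y v) \<partial>\<kappa> y) = enn2real (P 1 y) - enn2real (P (-1) y)"
    if "y \<in> space N" "P 1 y \<noteq> \<infinity>" "P (-1) y \<noteq> \<infinity>" for y
  proof -
    note [measurable] = \<phi>[OF that(1)]
    show "integrable (\<kappa> y) (\<lambda>v. g (\<phi> y v))" using that(2,3) by (simp add: real_integrable_def P_def)
    then show "(\<integral>v. g (\<phi> y v) \<partial>\<kappa> y) = enn2real (P 1 y) - enn2real (P (-1) y)"
      by (simp add: real_lebesgue_integral_def P_def)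
  qed
  show "AE y in N. integrable (\<kappa> y) (\<lambda>v. g (\<phi> y v))"
    using AEP[OF insertI1] AEP[OF insertI2[OF singletonI]] AE_space by eventually_elim (rule int)
  \<comment> \<open>On fibres where \<open>g\<close> is not integrable the Bochner integral is 0,
    which settles measurability on the exceptional set as well.\<close>
  have cases: "(\<integral>v. g (\<phi> y v) \<partial>\<kappa> y) =
      (if P 1 y \<noteq> \<infinity> \<and> P (-1) y \<noteq> \<infinity> then enn2real (P 1 y) - enn2real (P (-1) y) else 0)"
    if y: "y \<in> space N" for y
  proof (cases "P 1 y \<noteq> \<infinity> \<and> P (-1) y \<noteq> \<infinity>")
    case False
    then have "\<not> integrable (\<kappa> y) (\<lambda>v. g (\<phi> y v))" by (auto simp: real_integrable_def P_def)
    then show ?thesis using False by (auto simp: not_integrable_integral_eq)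
  qed (use eq[OF y] in simp)
  show meas_int [measurable]: "(\<lambda>y. \<integral>v. g (\<phi> y v) \<partial>\<kappa> y) \<in> borel_measurable N"
    by (subst measurable_cong[OF cases]) auto
  have intP: "integrable N (\<lambda>y. enn2real (P s y))" "(\<integral>y. enn2real (P s y) \<partial>N) = enn2real (\<integral>\<^sup>+y. P s y \<partial>N)"
    if s: "s \<in> {1, -1}" for s
  proof -
    have *: "(\<integral>\<^sup>+y. ennreal (enn2real (P s y)) \<partial>N) = (\<integral>\<^sup>+y. P s y \<partial>N)"
      using AEP[OF s] by (intro nn_integral_cong_AE) (auto elim!: eventually_mono simp: less_top)
    show "integrable N (\<lambda>y. enn2real (P s y))"
      using fin[OF s] by (intro integrableI_nonneg) (auto simp: * less_top)
    show "(\<integral>y. enn2real (P s y) \<partial>N) = enn2real (\<integral>\<^sup>+y. P s y \<partial>N)"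
      by (subst integral_eq_nn_integral) (auto simp: *)
  qed
  have "(\<integral>z. g z \<partial>M) = enn2real (\<integral>\<^sup>+y. P 1 y \<partial>N) - enn2real (\<integral>\<^sup>+y. P (-1) y \<partial>N)"
    using total[of 1] total[of "-1"] by (simp add: real_lebesgue_integral_def[OF g])
  also have "\<dots> = (\<integral>y. enn2real (P 1 y) - enn2real (P (-1) y) \<partial>N)"
    by (simp add: intP)
  also have "\<dots> = (\<integral>y. (\<integral>v. g (\<phi> y v) \<partial>\<kappa> y) \<partial>N)"
  proof -
    have ae: "AE y in N. (\<integral>v. g (\<phi> y v) \<partial>\<kappa> y) = enn2real (P 1 y) - enn2real (P (-1) y)"
      using AEP[OF insertI1] AEP[OF insertI2[OF singletonI]] AE_space by eventually_elim (rule eq)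
    show ?thesis using ae by (intro integral_cong_AE) (auto elim!: eventually_mono)
  qed
  finally show "(\<integral>z. g z \<partial>M) = (\<integral>y. (\<integral>v. g (\<phi> y v) \<partial>\<kappa> y) \<partial>N)" .
qed

subsection \<open>Measures on absolutely continuous curves\<close>

lemma AE_lebesgue_on_iff:
  assumes "S \<in> sets borel"
  shows "(AE t in lebesgue_on S. P t) \<longleftrightarrow> (AE t in lborel. t \<in> S \<longrightarrow> P t)"
  using assms by (simp add: AE_restrict_space_iff AE_completion_iff)

text \<open>Moves a time integral against the completed measure, as in (iii), to one against
  \<open>lborel\<close>, where Fubini's theorem for the product with \<open>\<eta>\<close> is
  available.\<close>

lemma nn_integral_lebesgue_on_eq_lborel:
  assumes S: "S \<in> sets borel" and u: "u \<in> borel_measurable lborel"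
    and ae: "AE t in lborel. t \<in> S \<longrightarrow> G t = u t"
  shows "(\<integral>\<^sup>+t. G t \<partial>lebesgue_on S) = (\<integral>\<^sup>+t. u t * indicator S t \<partial>lborel)"
proof -
  have "(\<integral>\<^sup>+t. G t \<partial>lebesgue_on S) = (\<integral>\<^sup>+t. u t \<partial>lebesgue_on S)"
    using ae by (intro nn_integral_cong_AE) (simp add: AE_lebesgue_on_iff[OF S])
  also have "\<dots> = (\<integral>\<^sup>+t. u t * indicator S t \<partial>lebesgue)"
    using S by (intro nn_integral_restrict_space) auto
  also have "\<dots> = (\<integral>\<^sup>+t. u t * indicator S t \<partial>lborel)"
    by (rule nn_integral_completion)
  finally show ?thesis .
qed

text \<open>Completeness of Lebesgue measure makes \<open>u\<close> measurable on \<open>S\<close>,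
  where it equals \<open>g\<close> almost everywhere; no measurability of \<open>u\<close> is
  assumed.\<close>

lemma integrable_lebesgue_on_AE_eq:
  fixes g u :: "'a::euclidean_space \<Rightarrow> real"
  assumes S: "S \<in> sets borel" and g: "integrable lborel g"
    and ae: "AE t in lborel. t \<in> S \<longrightarrow> g t = u t"
  shows "integrable (lebesgue_on S) u"
proof -
  have g': "integrable lebesgue (\<lambda>t. indicator S t *\<^sub>R g t)"
    using integrable_mult_indicator[OF _ g, of S] S g
    by (subst integrable_completion) auto
  have eq: "AE t in lebesgue. indicator S t *\<^sub>R g t = indicator S t *\<^sub>R u t"
    unfolding AE_completion_iff using ae by eventually_elim (auto simp: indicator_def)
  have "(\<lambda>t. indicator S t *\<^sub>R u t) \<in> borel_measurable lebesgue"
    by (rule borel_measurable_AE[OF borel_measurable_integrable[OF g'] eq])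
  then have "integrable lebesgue (\<lambda>t. indicator S t *\<^sub>R u t)"
    using eq by (rule integrable_cong_AE_imp[OF g'])
  then show ?thesis using S by (subst integrable_restrict_space) auto
qed

locale ac_curve_measure =
  fixes T :: real and \<eta> :: "(real \<Rightarrow> 'a::euclidean_space) measure"
  assumes T_pos: "0 < T"
    and prob_algebra: "\<eta> \<in> space (prob_algebra (curve_borel T))"
    and ac: "AE \<gamma> in \<eta>. absolutely_continuous_on 0 T \<gamma>"
    and finite_speed: "(\<integral>\<^sup>+t. (\<integral>\<^sup>+\<gamma>. norm (velocity T \<gamma> t) \<partial>\<eta>) \<partial>lebesgue_on {0..T}) < \<infinity>"
begin

sublocale prob_space \<eta>
  using prob_algebra by (simp add: space_prob_algebra)

lemma sets_curves [measurable_cong]: "sets \<eta> = sets (curve_borel T)"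
  using prob_algebra by (simp add: space_prob_algebra)

lemma sigma_finite_curves: "sigma_finite_measure \<eta>"
  by unfold_locales

sublocale pair_sigma_finite lborel \<eta>
  by unfold_locales

lemma measurable_marginal [measurable]: "t \<in> {0..T} \<Longrightarrow> eval_at t \<in> \<eta> \<rightarrow>\<^sub>M borel"
  using eval_at_measurable[of t T] by (simp add: measurable_cong_sets[OF sets_curves refl])

lemma prob_space_marginal: "t \<in> {0..T} \<Longrightarrow> prob_space (distr \<eta> borel (eval_at t))"
  by (intro prob_space_distr measurable_marginal)

lemma marginal_in_borel_probs: "t \<in> {0..T} \<Longrightarrow> distr \<eta> borel (eval_at t) \<in> borel_probs"
  by (simp add: space_prob_algebra prob_space_marginal)

text \<open>Among times in \<open>[0, T]\<close>, only the two end points are altered, a null set.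
  The result is jointly measurable and can be integrated over the whole line.\<close>

definition velocity0 :: "real \<times> (real \<Rightarrow> 'a) \<Rightarrow> 'a"
  where "velocity0 = (\<lambda>(t, \<gamma>). if t \<in> {0<..<T} then velocity T \<gamma> t else 0)"

lemma sets_pair: "sets (lborel \<Otimes>\<^sub>M \<eta>) = sets (borel \<Otimes>\<^sub>M curve_borel T)"
  by (intro sets_pair_measure_cong sets_curves sets_lborel)

lemma measurable_velocity0 [measurable]: "velocity0 \<in> borel_measurable (lborel \<Otimes>\<^sub>M \<eta>)"
  unfolding velocity0_def using measurable_velocity[of T] T_pos
  by (simp add: measurable_cong_sets[OF sets_pair refl])

lemma measurable_position [measurable]: "(\<lambda>x. snd x (clip T (fst x))) \<in> borel_measurable (lborel \<Otimes>\<^sub>M \<eta>)"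
  using measurable_eval_clip[of T] T_pos
  by (simp add: measurable_cong_sets[OF sets_pair refl] case_prod_beta)

lemma measurable_velocity_at:
  assumes "t \<in> {0<..<T}"
  shows "(\<lambda>\<gamma>. velocity T \<gamma> t) \<in> borel_measurable \<eta>"
  using measurable_compose_Pair1[OF _ measurable_velocity0, of t] assms by (simp add: velocity0_def)

lemma integrable_velocity0: "integrable (lborel \<Otimes>\<^sub>M \<eta>) velocity0"
proof (rule integrableI_bounded)
  have ends: "AE t in lborel. t \<noteq> 0 \<and> t \<noteq> T"
    using AE_lborel_singleton[of 0] AE_lborel_singleton[of T] by eventually_elim simp
  have "(\<integral>\<^sup>+x. norm (velocity0 x) \<partial>(lborel \<Otimes>\<^sub>M \<eta>)) = (\<integral>\<^sup>+t. (\<integral>\<^sup>+\<gamma>. norm (velocity0 (t, \<gamma>)) \<partial>\<eta>) \<partial>lborel)"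
    by (subst sigma_finite_measure.nn_integral_fst[OF sigma_finite_curves, symmetric]) simp_all
  also have "\<dots> = (\<integral>\<^sup>+t. (\<integral>\<^sup>+\<gamma>. norm (velocity0 (t, \<gamma>)) \<partial>\<eta>) * indicator {0..T} t \<partial>lborel)"
    by (intro nn_integral_cong) (auto simp: velocity0_def split: split_indicator)
  also have "\<dots> = (\<integral>\<^sup>+t. (\<integral>\<^sup>+\<gamma>. norm (velocity T \<gamma> t) \<partial>\<eta>) \<partial>lebesgue_on {0..T})"
  proof (rule nn_integral_lebesgue_on_eq_lborel[symmetric])
    show "(\<lambda>t. \<integral>\<^sup>+\<gamma>. norm (velocity0 (t, \<gamma>)) \<partial>\<eta>) \<in> borel_measurable lborel"
      by (rule sigma_finite_measure.borel_measurable_nn_integral_fst[OF sigma_finite_curves]) simp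
    show "AE t in lborel. t \<in> {0..T} \<longrightarrow>
        (\<integral>\<^sup>+\<gamma>. norm (velocity T \<gamma> t) \<partial>\<eta>) = (\<integral>\<^sup>+\<gamma>. norm (velocity0 (t, \<gamma>)) \<partial>\<eta>)"
      using ends by eventually_elim (auto simp: velocity0_def intro!: nn_integral_cong)
  qed simp
  also have "\<dots> < \<infinity>" by (rule finite_speed)
  finally show "(\<integral>\<^sup>+x. norm (velocity0 x) \<partial>(lborel \<Otimes>\<^sub>M \<eta>)) < \<infinity>" .
qed simp

text \<open>At interior times where the curve is differentiable, this is the time derivative of
  \<open>f\<close> along the curve.\<close>

definition rate :: "('a \<Rightarrow> real) \<Rightarrow> real \<times> (real \<Rightarrow> 'a) \<Rightarrow> real"
  where "rate f x = grad f (snd x (clip T (fst x))) \<bullet> velocity0 x"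

lemma integrable_rate:
  assumes f: "f \<in> test_functions"
  shows "integrable (lborel \<Otimes>\<^sub>M \<eta>) (rate f)"
proof -
  obtain C where C: "C \<ge> 0" "\<And>x. norm (grad f x) \<le> C" using grad_test_function_bounded[OF f] by blast
  have [measurable]: "grad f \<in> borel_measurable borel"
    by (rule borel_measurable_continuous_onI[OF continuous_on_grad_test_function[OF f]])
  show ?thesis
  proof (rule Bochner_Integration.integrable_bound)
    show "integrable (lborel \<Otimes>\<^sub>M \<eta>) (\<lambda>x. C * norm (velocity0 x))"
      using integrable_velocity0 by simp
    show "AE x in lborel \<Otimes>\<^sub>M \<eta>. norm (rate f x) \<le> norm (C * norm (velocity0 x))"
    proof (rule AE_I2)
      fix x
      show "norm (rate f x) \<le> norm (C * norm (velocity0 x))"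
        using Cauchy_Schwarz_ineq2[of "grad f (snd x (clip T (fst x)))" "velocity0 x"]
          mult_right_mono[OF C(2)[of "snd x (clip T (fst x))"] norm_ge_zero[of "velocity0 x"]] C(1)
        by (simp add: rate_def abs_mult)
    qed
  qed (simp add: rate_def[abs_def])
qed

text \<open>\<open>f\<close> is Lipschitz, so \<open>f\<close> along the curve is a primitive of
  some density \<open>h\<close>. At almost every time \<open>h\<close> is its derivative and the
  curve itself is differentiable, and there the chain rule identifies \<open>h s\<close> with
  \<open>rate f (s, \<gamma>)\<close>.\<close>

lemma test_function_along_curve:
  assumes \<gamma>: "\<gamma> \<in> space \<eta>" "absolutely_continuous_on 0 T \<gamma>" and f: "f \<in> test_functions" and t: "t \<in> {0..T}"
  shows "f (\<gamma> t) = f (\<gamma> 0) + (LINT s|lborel. indicator {..t} s * rate f (s, \<gamma>))"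
proof -
  obtain L where L: "\<And>x y. dist (f x) (f y) \<le> L * dist x y" using test_function_lipschitz[OF f] by blast
  obtain h where h: "integrable lborel h"
    "\<And>t. t \<in> {0..T} \<Longrightarrow> f (\<gamma> t) = f (\<gamma> 0) + (LINT s|lborel. indicator {..t} s * h s)"
    using absolutely_continuous_on_imp_primitive[OF T_pos absolutely_continuous_on_lipschitz_compose[OF \<gamma>(2) L]] by blast
  have int: "integrable lborel (\<lambda>s. indicator I s * h s)" if "I \<in> sets borel" for I
    using integrable_mult_indicator[OF _ h(1), of I] that by simp
  have "AE s in lborel. s \<in> {0..T} \<longrightarrow> ((\<lambda>t. f (\<gamma> t)) has_real_derivative h s) (at s within {0..T})"
    by (rule AE_has_real_derivative_primitive[OF h])
  \<comment> \<open>\<open>rate\<close> is 0 at \<open>T\<close>, where \<open>h\<close> may differ,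
    so this point is discarded.\<close>
  moreover have "AE s in lborel. s \<noteq> T" by (rule AE_lborel_singleton)
  \<comment> \<open>The values of \<open>h\<close> before time 0 are unknown, while
    \<open>rate\<close> vanishes there; hence the interval \<open>{0<..t}\<close> on the
    left.\<close>
  ultimately have "AE s in lborel. indicator {0<..t} s * h s = indicator {..t} s * rate f (s, \<gamma>)"
    using absolutely_continuous_on_AE_differentiable[OF T_pos \<gamma>(2)]
  proof eventually_elim
    fix s assume fs: "s \<in> {0..T} \<longrightarrow> ((\<lambda>t. f (\<gamma> t)) has_real_derivative h s) (at s within {0..T})"
      and ds: "s \<in> {0..T} \<longrightarrow> \<gamma> differentiable (at s within {0..T})" and sT: "s \<noteq> T"
    show "indicator {0<..t} s * h s = indicator {..t} s * rate f (s, \<gamma>)"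
    proof (cases "s \<in> {0<..<T}")
      case True
      then have s: "s \<in> {0..T}" and at: "at s within {0..T} = at s" by (auto simp: at_within_Icc_at)
      have "(\<gamma> has_vector_derivative velocity T \<gamma> s) (at s within {0..T})"
        using ds s by (simp add: velocity_def vector_derivative_works)
      then have "((\<lambda>t. f (\<gamma> t)) has_derivative (\<lambda>r. grad f (\<gamma> s) \<bullet> (r *\<^sub>R velocity T \<gamma> s))) (at s)"
        unfolding at has_vector_derivative_def
        by (rule has_derivative_compose[OF _ test_function_has_derivative[OF f]])
      then have "((\<lambda>t. f (\<gamma> t)) has_real_derivative (grad f (\<gamma> s) \<bullet> velocity T \<gamma> s)) (at s)"
        by (simp add: has_field_derivative_def mult_commute_abs)
      then have "h s = grad f (\<gamma> s) \<bullet> velocity T \<gamma> s"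
        using fs s unfolding at by (auto intro: DERIV_unique)
      then show ?thesis using True by (auto simp: rate_def velocity0_def clip_eq[OF s] indicator_def)
    next
      case False
      then show ?thesis using sT t by (auto simp: rate_def velocity0_def indicator_def)
    qed
  qed
  moreover have "(\<lambda>s. rate f (s, \<gamma>)) \<in> borel_measurable lborel"
    using measurable_Pair1[OF borel_measurable_integrable[OF integrable_rate[OF f]] \<gamma>(1)] by simp
  ultimately have "(LINT s|lborel. indicator {0<..t} s * h s) = (LINT s|lborel. indicator {..t} s * rate f (s, \<gamma>))"
    using h(1) by (intro integral_cong_AE) auto
  moreover have "(LINT s|lborel. indicator {0<..t} s * h s) =
      (LINT s|lborel. indicator {..t} s * h s) - (LINT s|lborel. indicator {..0} s * h s)"
    using t by (subst Bochner_Integration.integral_diff[symmetric])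
      (auto intro!: int Bochner_Integration.integral_cong split: split_indicator)
  \<comment> \<open>The formula for \<open>h\<close> at time 0 shows that its integral over
    \<open>{..0}\<close> is 0.\<close>
  ultimately show ?thesis using h(2)[OF t] h(2)[of 0] T_pos by (simp add: rate_def velocity0_def)
qed

lemma integral_marginal_eq:
  assumes f: "f \<in> test_functions" and t: "t \<in> {0..T}"
  shows "(LINT x|distr \<eta> borel (eval_at t). f x) =
    (LINT x|distr \<eta> borel (eval_at 0). f x) + (LINT s|lborel. indicator {..t} s * (LINT \<gamma>|\<eta>. rate f (s, \<gamma>)))"
proof -
  have [measurable]: "f \<in> borel_measurable borel"
    by (rule borel_measurable_continuous_onI[OF test_function_continuous_on[OF f]])
  obtain C where C: "C \<ge> 0" "\<And>x. \<bar>f x\<bar> \<le> C" using test_function_bounded[OF f] by blast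
  have marg: "(LINT x|distr \<eta> borel (eval_at r). f x) = (LINT \<gamma>|\<eta>. f (\<gamma> r))"
    and int: "integrable \<eta> (\<lambda>\<gamma>. f (\<gamma> r))" if r: "r \<in> {0..T}" for r
  proof -
    note [measurable] = measurable_marginal[OF r]
    show "(LINT x|distr \<eta> borel (eval_at r). f x) = (LINT \<gamma>|\<eta>. f (\<gamma> r))"
      by (subst integral_distr) (auto simp: eval_at_def)
    have "integrable \<eta> (\<lambda>\<gamma>. f (eval_at r \<gamma>))"
    proof (rule integrable_const_bound[where B=C])
      show "AE \<gamma> in \<eta>. norm (f (eval_at r \<gamma>)) \<le> C" by (rule AE_I2) (simp add: C(2))
    qed simp
    then show "integrable \<eta> (\<lambda>\<gamma>. f (\<gamma> r))" by (simp add: eval_at_def)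
  qed
  define R where "R = (\<lambda>(s, \<gamma>). indicator {..t} s * rate f (s, \<gamma>))"
  have R: "integrable (lborel \<Otimes>\<^sub>M \<eta>) R"
  proof -
    have "{..t} \<times> space \<eta> \<in> sets (lborel \<Otimes>\<^sub>M \<eta>)" by auto
    from integrable_mult_indicator[OF this integrable_rate[OF f]]
    have *: "integrable (lborel \<Otimes>\<^sub>M \<eta>) (\<lambda>x. indicator ({..t} \<times> space \<eta>) x *\<^sub>R rate f x)" .
    have "integrable (lborel \<Otimes>\<^sub>M \<eta>) R \<longleftrightarrow> integrable (lborel \<Otimes>\<^sub>M \<eta>) (\<lambda>x. indicator ({..t} \<times> space \<eta>) x *\<^sub>R rate f x)"
      by (intro Bochner_Integration.integrable_cong refl)
         (auto simp: R_def space_pair_measure indicator_def)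
    with * show ?thesis by simp
  qed
  have intR: "integrable \<eta> (\<lambda>\<gamma>. LINT s|lborel. R (s, \<gamma>))"
    using integrable_snd[of "\<lambda>s \<gamma>. R (s, \<gamma>)"] R by simp
  have int0: "integrable \<eta> (\<lambda>\<gamma>. f (\<gamma> 0))" using int[of 0] T_pos by simp
  have "(LINT \<gamma>|\<eta>. f (\<gamma> t)) = (LINT \<gamma>|\<eta>. f (\<gamma> 0) + (LINT s|lborel. R (s, \<gamma>)))"
  proof (rule integral_cong_AE)
    show "AE \<gamma> in \<eta>. f (\<gamma> t) = f (\<gamma> 0) + (LINT s|lborel. R (s, \<gamma>))"
      using ac AE_space
    proof eventually_elim
      case (elim \<gamma>)
      from test_function_along_curve[OF elim(2,1) f t] show ?case by (simp add: R_def)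
    qed
    show "(\<lambda>\<gamma>. f (\<gamma> t)) \<in> borel_measurable \<eta>"
      using int[OF t] by (rule borel_measurable_integrable)
    show "(\<lambda>\<gamma>. f (\<gamma> 0) + (LINT s|lborel. R (s, \<gamma>))) \<in> borel_measurable \<eta>"
      using int0 intR by (intro borel_measurable_integrable Bochner_Integration.integrable_add)
  qed
  also have "\<dots> = (LINT \<gamma>|\<eta>. f (\<gamma> 0)) + (LINT \<gamma>|\<eta>. (LINT s|lborel. R (s, \<gamma>)))"
    by (rule Bochner_Integration.integral_add[OF int0 intR])
  also have "(LINT \<gamma>|\<eta>. (LINT s|lborel. R (s, \<gamma>))) = (LINT s|lborel. (LINT \<gamma>|\<eta>. R (s, \<gamma>)))"
    using Fubini_integral[of "\<lambda>s \<gamma>. R (s, \<gamma>)"] R by simp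
  also have "\<dots> = (LINT s|lborel. indicator {..t} s * (LINT \<gamma>|\<eta>. rate f (s, \<gamma>)))"
    by (simp add: R_def)
  finally show ?thesis using marg[OF t] marg[of 0] T_pos by simp
qed

text \<open>The two moment bounds at the fixed time \<open>t\<close> act on the fibres: they make
  the velocity integrable for almost every \<open>\<kappa> y\<close> and \<open>v\<close> integrable
  for almost every \<open>\<nu> y\<close>, so that the constant vector \<open>grad f y\<close> can
  be moved into and out of the two mean values.\<close>

lemma integral_rate_eq:
  assumes t: "t \<in> {0<..<T}" and f: "f \<in> test_functions"
    and VM: "sets VM = sets borel" "distr VM borel fst = distr \<eta> borel (eval_at t)"
    and \<nu>: "disintegration_fst VM \<nu>"
    and \<kappa>: "disintegration_along \<eta> (eval_at t) \<kappa>"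
    and eq: "AE y in distr \<eta> borel (eval_at t).
        (LINT \<gamma>:{\<gamma> \<in> space \<eta>. eval_at t \<gamma> = y}|\<kappa> y. velocity T \<gamma> t) = (LINT v|\<nu> y. v)"
    and fin_curves: "(\<integral>\<^sup>+\<gamma>. norm (velocity T \<gamma> t) \<partial>\<eta>) < \<infinity>"
    and fin_field: "(\<integral>\<^sup>+(x, v). norm v \<partial>VM) < \<infinity>"
  shows "(LINT \<gamma>|\<eta>. rate f (t, \<gamma>)) = (LINT (x, v)|VM. grad f x \<bullet> v)"
    and "integrable VM (\<lambda>(x, v). grad f x \<bullet> v)"
proof -
  let ?\<mu> = "distr \<eta> borel (eval_at t)"
  have t': "t \<in> {0..T}" and clip: "clip T t = t" using t by (auto simp: clip_def)
  have [measurable]: "eval_at t \<in> \<eta> \<rightarrow>\<^sub>M borel" by (rule measurable_marginal[OF t'])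
  have [measurable]: "grad f \<in> borel_measurable borel"
    by (rule borel_measurable_continuous_onI[OF continuous_on_grad_test_function[OF f]])
  have vm [measurable]: "(\<lambda>\<gamma>. velocity T \<gamma> t) \<in> borel_measurable \<eta>" by (rule measurable_velocity_at[OF t])
  have [measurable_cong]: "sets VM = sets (borel \<Otimes>\<^sub>M borel)" by (simp only: VM(1) borel_prod)
  obtain C where C: "C \<ge> 0" "\<And>x. norm (grad f x) \<le> C" using grad_test_function_bounded[OF f] by blast
  have bound: "\<bar>grad f x \<bullet> v\<bar> \<le> C * norm v" for x v
    using Cauchy_Schwarz_ineq2[of "grad f x" v] mult_right_mono[OF C(2)[of x] norm_ge_zero[of v]] by simp
  have rate: "rate f (t, \<gamma>) = grad f (eval_at t \<gamma>) \<bullet> velocity T \<gamma> t" for \<gamma>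
    using t by (simp add: rate_def velocity0_def clip eval_at_def)

  have intV: "integrable VM (\<lambda>z. norm (snd z))"
    using fin_field by (intro integrableI_bounded) (auto simp: case_prod_beta)
  show int_field: "integrable VM (\<lambda>(x, v). grad f x \<bullet> v)"
  proof (rule Bochner_Integration.integrable_bound)
    show "integrable VM (\<lambda>z. C * norm (snd z))" using intV by simp
    show "AE z in VM. norm (case z of (x, v) \<Rightarrow> grad f x \<bullet> v) \<le> norm (C * norm (snd z))"
      using bound C(1) by (intro AE_I2) (auto simp: abs_mult)
  qed simp
  have int_vel: "integrable \<eta> (\<lambda>\<gamma>. norm (velocity T \<gamma> t))"
    using fin_curves by (intro integrableI_bounded) auto
  have int_rate: "integrable \<eta> (\<lambda>\<gamma>. grad f (eval_at t \<gamma>) \<bullet> velocity T \<gamma> t)"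
  proof (rule Bochner_Integration.integrable_bound)
    show "integrable \<eta> (\<lambda>\<gamma>. C * norm (velocity T \<gamma> t))" using int_vel by simp
    show "AE \<gamma> in \<eta>. norm (grad f (eval_at t \<gamma>) \<bullet> velocity T \<gamma> t) \<le> norm (C * norm (velocity T \<gamma> t))"
      using bound C(1) by (intro AE_I2) (auto simp: abs_mult)
  qed simp

  have \<kappa>m: "\<kappa> \<in> borel \<rightarrow>\<^sub>M prob_algebra \<eta>" and \<kappa>c: "AE y in ?\<mu>. AE z in \<kappa> y. eval_at t z = y"
    and \<kappa>n: "\<And>u :: _ \<Rightarrow> ennreal. u \<in> borel_measurable \<eta> \<Longrightarrow> (\<integral>\<^sup>+z. u z \<partial>\<eta>) = (\<integral>\<^sup>+y. (\<integral>\<^sup>+z. u z \<partial>\<kappa> y) \<partial>?\<mu>)"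
    using \<kappa> by (auto simp: disintegration_along_def)
  have \<kappa>s: "sets (\<kappa> y) = sets \<eta>" for y
    using measurable_space[OF \<kappa>m, of y] by (simp add: space_prob_algebra)
  have \<kappa>u: "(\<lambda>y. \<integral>\<^sup>+z. u z \<partial>\<kappa> y) \<in> borel_measurable ?\<mu>" if "u \<in> borel_measurable \<eta>" for u :: "_ \<Rightarrow> ennreal"
    using measurable_compose[OF measurable_prob_algebraD[OF \<kappa>m] nn_integral_measurable_subprob_algebra[OF that]] by simp
  have \<kappa>id: "(\<lambda>z. z) \<in> \<kappa> y \<rightarrow>\<^sub>M \<eta>" for y
    using measurable_ident_sets[OF \<kappa>s] .
  have dis_\<eta>: "AE y in ?\<mu>. integrable (\<kappa> y) u"
      "(\<lambda>y. \<integral>z. u z \<partial>\<kappa> y) \<in> borel_measurable ?\<mu>"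
      "(\<integral>z. u z \<partial>\<eta>) = (\<integral>y. (\<integral>z. u z \<partial>\<kappa> y) \<partial>?\<mu>)"
    if u: "integrable \<eta> u" for u :: "_ \<Rightarrow> real"
  proof -
    show "AE y in ?\<mu>. integrable (\<kappa> y) u"
      by (rule AE_integrable_disintegration[where M=\<eta> and N="?\<mu>" and \<kappa>=\<kappa> and \<phi>="\<lambda>y z. z"])
      (erule \<kappa>n | erule \<kappa>u | rule \<kappa>id | rule u)+
    show "(\<lambda>y. \<integral>z. u z \<partial>\<kappa> y) \<in> borel_measurable ?\<mu>"
      by (rule borel_measurable_integral_disintegration[where M=\<eta> and N="?\<mu>" and \<kappa>=\<kappa> and \<phi>="\<lambda>y z. z"])
      (erule \<kappa>n | erule \<kappa>u | rule \<kappa>id | rule u)+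
    show "(\<integral>z. u z \<partial>\<eta>) = (\<integral>y. (\<integral>z. u z \<partial>\<kappa> y) \<partial>?\<mu>)"
      by (rule integral_disintegration[where M=\<eta> and N="?\<mu>" and \<kappa>=\<kappa> and \<phi>="\<lambda>y z. z"])
      (erule \<kappa>n | erule \<kappa>u | rule \<kappa>id | rule u)+
  qed

  have \<nu>m: "\<nu> \<in> borel \<rightarrow>\<^sub>M prob_algebra borel"
    and \<nu>n: "\<And>u. u \<in> borel_measurable borel \<Longrightarrow> (\<integral>\<^sup>+z. u z \<partial>VM) = (\<integral>\<^sup>+x. (\<integral>\<^sup>+v. u (x, v) \<partial>\<nu> x) \<partial>?\<mu>)"
    using \<nu> by (auto simp: disintegration_fst_def VM(2))
  have \<nu>s [measurable_cong]: "sets (\<nu> x) = sets borel" for x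
    using measurable_space[OF \<nu>m, of x] by (simp add: space_prob_algebra)
  have \<nu>n': "(\<integral>\<^sup>+z. u z \<partial>VM) = (\<integral>\<^sup>+x. (\<integral>\<^sup>+v. u (x, v) \<partial>\<nu> x) \<partial>?\<mu>)" if "u \<in> borel_measurable VM" for u
    using \<nu>n that by (simp add: measurable_cong_sets[OF VM(1) refl])
  have \<nu>u: "(\<lambda>x. \<integral>\<^sup>+v. u (x, v) \<partial>\<nu> x) \<in> borel_measurable ?\<mu>" if "u \<in> borel_measurable VM" for u :: "_ \<Rightarrow> ennreal"
  proof -
    have "(\<lambda>(x, v). u (x, v)) \<in> borel_measurable (borel \<Otimes>\<^sub>M borel)"
      using that by (simp add: measurable_cong_sets[OF VM(1) refl] borel_prod)
    from nn_integral_measurable_subprob_algebra2[OF this measurable_prob_algebraD[OF \<nu>m]] show ?thesis by simp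
  qed
  have \<nu>p: "Pair x \<in> \<nu> x \<rightarrow>\<^sub>M VM" for x
    by (simp add: measurable_cong_sets[OF \<nu>s VM(1)])
  have dis_\<nu>: "AE x in ?\<mu>. integrable (\<nu> x) (\<lambda>v. u (x, v))"
      "(\<lambda>x. \<integral>v. u (x, v) \<partial>\<nu> x) \<in> borel_measurable ?\<mu>"
      "(\<integral>z. u z \<partial>VM) = (\<integral>x. (\<integral>v. u (x, v) \<partial>\<nu> x) \<partial>?\<mu>)"
    if u: "integrable VM u" for u :: "_ \<Rightarrow> real"
  proof -
    show "AE x in ?\<mu>. integrable (\<nu> x) (\<lambda>v. u (x, v))"
      by (rule AE_integrable_disintegration[where M=VM and N="?\<mu>" and \<kappa>=\<nu> and \<phi>="Pair"])
      (erule \<nu>n' | erule \<nu>u | rule \<nu>p | rule u)+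
    show "(\<lambda>x. \<integral>v. u (x, v) \<partial>\<nu> x) \<in> borel_measurable ?\<mu>"
      by (rule borel_measurable_integral_disintegration[where M=VM and N="?\<mu>" and \<kappa>=\<nu> and \<phi>="Pair"])
      (erule \<nu>n' | erule \<nu>u | rule \<nu>p | rule u)+
    show "(\<integral>z. u z \<partial>VM) = (\<integral>x. (\<integral>v. u (x, v) \<partial>\<nu> x) \<partial>?\<mu>)"
      by (rule integral_disintegration[where M=VM and N="?\<mu>" and \<kappa>=\<nu> and \<phi>="Pair"])
      (erule \<nu>n' | erule \<nu>u | rule \<nu>p | rule u)+
  qed

  have "(LINT \<gamma>|\<eta>. rate f (t, \<gamma>)) = (LINT y|?\<mu>. (LINT \<gamma>|\<kappa> y. grad f (eval_at t \<gamma>) \<bullet> velocity T \<gamma> t))"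
    unfolding rate by (rule dis_\<eta>(3)[OF int_rate])
  also have "\<dots> = (LINT y|?\<mu>. (LINT v|\<nu> y. grad f y \<bullet> v))"
  proof (rule integral_cong_AE)
    show "(\<lambda>y. LINT \<gamma>|\<kappa> y. grad f (eval_at t \<gamma>) \<bullet> velocity T \<gamma> t) \<in> borel_measurable ?\<mu>"
      by (rule dis_\<eta>(2)[OF int_rate])
    show "(\<lambda>y. LINT v|\<nu> y. grad f y \<bullet> v) \<in> borel_measurable ?\<mu>"
      using dis_\<nu>(2)[OF int_field] by simp
    show "AE y in ?\<mu>. (LINT \<gamma>|\<kappa> y. grad f (eval_at t \<gamma>) \<bullet> velocity T \<gamma> t) = (LINT v|\<nu> y. grad f y \<bullet> v)"
      using dis_\<eta>(1)[OF int_vel] dis_\<nu>(1)[OF intV] \<kappa>c eq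
    proof eventually_elim
      fix y
      assume y: "integrable (\<kappa> y) (\<lambda>\<gamma>. norm (velocity T \<gamma> t))" "integrable (\<nu> y) (\<lambda>v. norm (snd (y, v)))"
        and fibre: "AE z in \<kappa> y. eval_at t z = y"
        and means: "(LINT \<gamma>:{\<gamma> \<in> space \<eta>. eval_at t \<gamma> = y}|\<kappa> y. velocity T \<gamma> t) = (LINT v|\<nu> y. v)"
      note \<kappa>_meas = measurable_cong_sets[OF \<kappa>s refl, THEN equalityD2, THEN subsetD]
      have vel: "integrable (\<kappa> y) (\<lambda>\<gamma>. velocity T \<gamma> t)"
        by (rule integrable_norm_cancel[OF y(1) \<kappa>_meas[OF vm]])
      have id: "integrable (\<nu> y) (\<lambda>v. v)"
        by (rule integrable_norm_cancel[OF y(2)[unfolded snd_conv] measurable_ident_sets[OF \<nu>s]])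
      have sp: "space (\<kappa> y) = space \<eta>" by (rule sets_eq_imp_space_eq[OF \<kappa>s])
      have "(LINT \<gamma>|\<kappa> y. grad f (eval_at t \<gamma>) \<bullet> velocity T \<gamma> t) = (LINT \<gamma>|\<kappa> y. grad f y \<bullet> velocity T \<gamma> t)"
      proof (rule integral_cong_AE)
        show "AE \<gamma> in \<kappa> y. grad f (eval_at t \<gamma>) \<bullet> velocity T \<gamma> t = grad f y \<bullet> velocity T \<gamma> t"
          using fibre by eventually_elim simp
        show "(\<lambda>\<gamma>. grad f (eval_at t \<gamma>) \<bullet> velocity T \<gamma> t) \<in> borel_measurable (\<kappa> y)"
          by (rule \<kappa>_meas[OF borel_measurable_integrable[OF int_rate]])
        show "(\<lambda>\<gamma>. grad f y \<bullet> velocity T \<gamma> t) \<in> borel_measurable (\<kappa> y)"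
          by (rule \<kappa>_meas[OF borel_measurable_inner[OF borel_measurable_const vm]])
      qed
      also have "\<dots> = grad f y \<bullet> (LINT \<gamma>|\<kappa> y. velocity T \<gamma> t)"
        using vel by (intro integral_inner_right)
      \<comment> \<open>\<open>\<kappa> y\<close> is concentrated on the fibre, so the integral over
        the whole space is the fibre integral of (ii).\<close>
      also have "(LINT \<gamma>|\<kappa> y. velocity T \<gamma> t) = (LINT \<gamma>:{\<gamma> \<in> space \<eta>. eval_at t \<gamma> = y}|\<kappa> y. velocity T \<gamma> t)"
        unfolding set_lebesgue_integral_def
      proof (rule integral_cong_AE)
        show "AE \<gamma> in \<kappa> y. velocity T \<gamma> t = indicator {\<gamma> \<in> space \<eta>. eval_at t \<gamma> = y} \<gamma> *\<^sub>R velocity T \<gamma> t"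
          using fibre AE_space by eventually_elim (simp add: sp)
        have "{\<gamma> \<in> space \<eta>. eval_at t \<gamma> = y} = eval_at t -` {y} \<inter> space \<eta>" by auto
        then have fibre_set: "{\<gamma> \<in> space \<eta>. eval_at t \<gamma> = y} \<in> sets \<eta>"
          using measurable_sets[of "eval_at t" \<eta> borel "{y}"] by simp
        show "(\<lambda>\<gamma>. indicator {\<gamma> \<in> space \<eta>. eval_at t \<gamma> = y} \<gamma> *\<^sub>R velocity T \<gamma> t) \<in> borel_measurable (\<kappa> y)"
          by (rule \<kappa>_meas[OF borel_measurable_scaleR[OF borel_measurable_indicator[OF fibre_set] vm]])
        show "(\<lambda>\<gamma>. velocity T \<gamma> t) \<in> borel_measurable (\<kappa> y)"
          by (rule \<kappa>_meas[OF vm])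
      qed
      also have "\<dots> = (LINT v|\<nu> y. v)" by (rule means)
      also have "grad f y \<bullet> \<dots> = (LINT v|\<nu> y. grad f y \<bullet> v)"
        using id by (intro integral_inner_right[symmetric])
      finally show "(LINT \<gamma>|\<kappa> y. grad f (eval_at t \<gamma>) \<bullet> velocity T \<gamma> t) = (LINT v|\<nu> y. grad f y \<bullet> v)" .
    qed
  qed
  also have "\<dots> = (LINT (x, v)|VM. grad f x \<bullet> v)"
    using dis_\<nu>(3)[OF int_field] by simp
  finally show "(LINT \<gamma>|\<eta>. rate f (t, \<gamma>)) = (LINT (x, v)|VM. grad f x \<bullet> v)" .
qed

end

section \<open>Verification of the solution property\<close>

theorem theorem3p3:
  fixes T :: real
    and V :: "'a::euclidean_space measure \<Rightarrow> ('a \<times> 'a) measure"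
    and \<mu>0 :: "'a measure"
    and \<eta> :: "(real \<Rightarrow> 'a) measure"
    and \<nu> :: "'a measure \<Rightarrow> 'a \<Rightarrow> 'a measure"
    and \<eta>d :: "real \<Rightarrow> 'a \<Rightarrow> (real \<Rightarrow> 'a) measure"
  assumes "T > 0"
    and "prob_vector_field V"
    and "\<mu>0 \<in> borel_probs"
    and "\<eta> \<in> space (prob_algebra (curve_borel T))"
    and "distr \<eta> borel (eval_at 0) = \<mu>0"
    and "\<And>\<mu>. \<mu> \<in> borel_probs \<Longrightarrow> disintegration_fst (V \<mu>) (\<nu> \<mu>)"
    and "\<And>t. t \<in> {0..T} \<Longrightarrow> disintegration_along \<eta> (eval_at t) (\<eta>d t)"
    and i: "AE \<gamma> in \<eta>. absolutely_continuous_on 0 T \<gamma>"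
    and ii: "AE t in lebesgue_on {0..T}. AE y in distr \<eta> borel (eval_at t).
        (LINT \<gamma>:{\<gamma> \<in> space \<eta>. eval_at t \<gamma> = y}|\<eta>d t y. velocity T \<gamma> t)
          = (LINT v|\<nu> (distr \<eta> borel (eval_at t)) y. v)"
    and iii_curves: "(\<integral>\<^sup>+t. (\<integral>\<^sup>+\<gamma>. norm (velocity T \<gamma> t) \<partial>\<eta>) \<partial>lebesgue_on {0..T}) < \<infinity>"
    and iii_field_meas: "(\<lambda>t. \<integral>\<^sup>+(x, v). norm v \<partial>V (distr \<eta> borel (eval_at t)))
        \<in> borel_measurable (lebesgue_on {0..T})"
    and iii_field: "(\<integral>\<^sup>+t. (\<integral>\<^sup>+(x, v). norm v \<partial>V (distr \<eta> borel (eval_at t))) \<partial>lebesgue_on {0..T}) < \<infinity>"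
  shows "mde_solution T V \<mu>0 (\<lambda>t. distr \<eta> borel (eval_at t))"
proof -
  interpret ac_curve_measure T \<eta>
    using assms(1) assms(4) i iii_curves by unfold_locales
  let ?\<mu> = "\<lambda>t. distr \<eta> borel (eval_at t)"
  have V: "sets (V (?\<mu> t)) = sets borel" "distr (V (?\<mu> t)) borel fst = ?\<mu> t" if "t \<in> {0..T}" for t
    using assms(2) marginal_in_borel_probs[OF that] by (auto simp: prob_vector_field_def space_prob_algebra)
  \<comment> \<open>Integrability of \<open>velocity0\<close> on the product gives finiteness at
    almost every time.\<close>
  have fin_curves: "AE t in lborel. t \<in> {0<..<T} \<longrightarrow> (\<integral>\<^sup>+\<gamma>. norm (velocity T \<gamma> t) \<partial>\<eta>) < \<infinity>"
    using AE_integrable_fst'[OF integrable_velocity0]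
    by eventually_elim (auto simp: integrable_iff_bounded velocity0_def)
  \<comment> \<open>\<open>nn_integral\<close> is a lower integral, so a finite value yields an
    almost everywhere finite integrand only if that integrand is measurable;
    \<open>iii_field_meas\<close> supplies this.\<close>
  have fin_field: "AE t in lborel. t \<in> {0..T} \<longrightarrow> (\<integral>\<^sup>+(x, v). norm v \<partial>V (?\<mu> t)) < \<infinity>"
    using nn_integral_noteq_infinite[OF iii_field_meas] iii_field
    by (simp add: AE_lebesgue_on_iff less_top)
  have ends: "AE t in lborel. t \<noteq> 0 \<and> t \<noteq> T"
    using AE_lborel_singleton[of 0] AE_lborel_singleton[of T] by eventually_elim simp
  show ?thesis
    unfolding mde_solution_def
  proof (intro conjI ballI)
    show "?\<mu> t \<in> borel_probs" if "t \<in> {0..T}" for t by (rule marginal_in_borel_probs[OF that])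
    show "?\<mu> 0 = \<mu>0" by fact
    fix f :: "'a \<Rightarrow> real" assume f: "f \<in> test_functions"
    define g where "g t = (LINT \<gamma>|\<eta>. rate f (t, \<gamma>))" for t
    have g: "integrable lborel g"
      unfolding g_def by (rule integrable_fst'[OF integrable_rate[OF f]])
    have "AE t in lborel. t \<in> {0..T} \<longrightarrow> (AE y in ?\<mu> t.
        (LINT \<gamma>:{\<gamma> \<in> space \<eta>. eval_at t \<gamma> = y}|\<eta>d t y. velocity T \<gamma> t) = (LINT v|\<nu> (?\<mu> t) y. v))"
      using ii by (simp add: AE_lebesgue_on_iff)
    \<comment> \<open>The exceptional times come from (ii), from the two bounds of (iii) and from
      the end points; none of them depends on \<open>f\<close>.\<close>
    with fin_curves fin_field ends
    have field: "AE t in lborel. t \<in> {0..T} \<longrightarrow>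
        g t = (LINT (x, v)|V (?\<mu> t). grad f x \<bullet> v) \<and> integrable (V (?\<mu> t)) (\<lambda>(x, v). grad f x \<bullet> v)"
    proof eventually_elim
      case (elim t)
      show ?case
      proof
        assume t: "t \<in> {0..T}"
        then have "t \<in> {0<..<T}" using elim by auto
        from integral_rate_eq[OF this f V[OF t] assms(6)[OF marginal_in_borel_probs[OF t]] assms(7)[OF t]]
        show "g t = (LINT (x, v)|V (?\<mu> t). grad f x \<bullet> v) \<and> integrable (V (?\<mu> t)) (\<lambda>(x, v). grad f x \<bullet> v)"
          using elim t \<open>t \<in> {0<..<T}\<close> by (simp add: g_def)
      qed
    qed
    have primitive: "(LINT x|?\<mu> t. f x) = (LINT x|?\<mu> 0. f x) + (LINT s|lborel. indicator {..t} s * g s)"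
      if "t \<in> {0..T}" for t
      unfolding g_def by (rule integral_marginal_eq[OF f that])
    show "AE t in lebesgue_on {0..T}. integrable (V (?\<mu> t)) (\<lambda>(x, v). grad f x \<bullet> v)"
      using field by (auto simp: AE_lebesgue_on_iff elim!: eventually_mono)
    show "integrable (lebesgue_on {0..T}) (\<lambda>t. LINT (x, v)|V (?\<mu> t). grad f x \<bullet> v)"
      using field by (intro integrable_lebesgue_on_AE_eq[OF _ g]) (auto elim!: eventually_mono)
    show "absolutely_continuous_on 0 T (\<lambda>t. LINT x|?\<mu> t. f x)"
      by (rule absolutely_continuous_on_primitive[OF g primitive])
    have "AE t in lborel. t \<in> {0..T} \<longrightarrow> ((\<lambda>s. LINT x|?\<mu> s. f x) has_real_derivative g t) (at t within {0..T})"
      by (rule AE_has_real_derivative_primitive[OF g primitive])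
    with field have "AE t in lborel. t \<in> {0..T} \<longrightarrow> ((\<lambda>s. LINT x|?\<mu> s. f x) has_real_derivative
        (LINT (x, v)|V (?\<mu> t). grad f x \<bullet> v)) (at t within {0..T})"
      by eventually_elim auto
    then show "AE t in lebesgue_on {0..T}. ((\<lambda>s. LINT x|?\<mu> s. f x) has_real_derivative
        (LINT (x, v)|V (?\<mu> t). grad f x \<bullet> v)) (at t within {0..T})"
      by (simp add: AE_lebesgue_on_iff)
  qed
qed

end
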